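(* Let $(M,E)$ be a Finsler manifold and let $L$ be a semibasic vector $1$-form on $TM$ that is conservative with respect to the energy function $E$. Then the $L$-Ehresmann connection $\mathbf{h}_L=\mathbf{h}_0+L+[J,(d_LE)^{\#}]$ is conservative, i.e. $d_{\mathbf{h}_L}E=0$.
   Context: $M$ is a connected smooth $n$-dimensional manifold (Hausdorff, countable base), $TM$ its tangent bundle, $\overset{\circ}{T}M\subset TM$ the open submanifold of nonzero tangent vectors. $C$ is the Liouville vector field on $TM$ and $J$ is the vertical endomorphism of $TM$ (the $(1,1)$ tensor with image and kernel the vertical vector fields, $[J,J]=0$, $[J,C]=J$). A vector $1$-form is a $(1,1)$ tensor field. For a vector $1$-form $K$ and a function $\varphi$, $d_K\varphi:=d\varphi\circ K$. For a vector field $Y$, $[K,Y]$ is the vector $1$-form $[K,Y]X=[KX,Y]-K[X,Y]$. A vector $1$-form $L$ is semibasic if $L\circ J=0$ and $J\circ L=0$. A Finsler manifold $(M,E)$: $E:TM\to\mathbb{R}$ with $E(0)=0$, $E>0$ on $\overset{\circ}{T}M$, $E$ of class $C^1$ on $TM$ and smooth on $\overset{\circ}{T}M$, $E$ positively homogeneous of degree $2$ ($CE=2E$), and the fundamental $2$-form $\omega:=d\,d_JE$ nondegenerate. For a $1$-form $\beta$, $\beta^{\#}$ is the unique vector field (smooth in general only on $\overset{\circ}{T}M$) with $i_{\beta^{\#}}\omega=\beta$. An Ehresmann connection is a vector $1$-form $\mathbf{h}$ (smooth in general only on $\overset{\circ}{T}M$) with $\mathbf{h}^2=\mathbf{h}$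 and $\ker\mathbf{h}$ the vertical vector fields; it is conservative with respect to $E$ if $d_{\mathbf{h}}E=0$. A semibasic vector $1$-form is conservative with respect to $E$ if it is a difference of two conservative Ehresmann connections (equivalently, $d_LE=0$). The canonical spray is $S_0:=-(dE)^{\#}$ over $\overset{\circ}{T}M$, $S_0(0):=0$, and the Berwald connection is $\mathbf{h}_0:=\frac12(\mathrm{id}+[J,S_0])$. *)

theory Defs
  imports "HOL-Analysis.Analysis"
begin

section \<open>Smooth manifolds\<close>

text \<open>Intended for open \<open>S\<close> in a finite-dimensional space, where continuity of all iterated
  directional derivatives of order at most \<open>k\<close> is the usual class \<open>C\<^sup>k\<close>.\<close>

fun Ck_on :: "nat \<Rightarrow> ('a::real_normed_vector \<Rightarrow> 'b::real_normed_vector) \<Rightarrow> 'a set \<Rightarrow> bool" where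
  "Ck_on 0 f S \<longleftrightarrow> continuous_on S f"
| "Ck_on (Suc k) f S \<longleftrightarrow>
     (\<forall>x\<in>S. f differentiable at x) \<and> (\<forall>v. Ck_on k (\<lambda>x. frechet_derivative f (at x) v) S)"

definition smooth_on :: "('a::real_normed_vector \<Rightarrow> 'b::real_normed_vector) \<Rightarrow> 'a set \<Rightarrow> bool" where
  "smooth_on f S \<longleftrightarrow> (\<forall>k. Ck_on k f S)"

text \<open>A chart is a coordinate domain with a coordinate map; only the values of the map on the domain
  matter. The dimension of the manifold is \<open>DIM('e)\<close>.\<close>

type_synonym ('a, 'e) chart = "'a set \<times> ('a \<Rightarrow> 'e)"

abbreviation chart_inv :: "('a, 'e) chart \<Rightarrow> 'e \<Rightarrow> 'a" where
  "chart_inv c \<equiv> inv_into (fst c) (snd c)"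

definition carrier_of :: "('a, 'e) chart set \<Rightarrow> 'a set" where
  "carrier_of A = (\<Union>c\<in>A. fst c)"

definition charts_at :: "('a, 'e) chart set \<Rightarrow> 'a \<Rightarrow> ('a, 'e) chart set" where
  "charts_at A p = {c \<in> A. p \<in> fst c}"

definition smooth_atlas :: "('a, 'e::euclidean_space) chart set \<Rightarrow> bool" where
  "smooth_atlas A \<longleftrightarrow>
     (\<forall>c\<in>A. inj_on (snd c) (fst c)) \<and>
     (\<forall>c\<in>A. \<forall>d\<in>A. open (snd c ` (fst c \<inter> fst d)) \<and>
        smooth_on (snd d \<circ> chart_inv c) (snd c ` (fst c \<inter> fst d)))"

text \<open>The manifold topology is the one for which all charts are homeomorphisms onto open sets.\<close>

definition manifold_open :: "('a, 'e::euclidean_space) chart set \<Rightarrow> 'a set \<Rightarrow> bool" where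
  "manifold_open A W \<longleftrightarrow> W \<subseteq> carrier_of A \<and> (\<forall>c\<in>A. open (snd c ` (fst c \<inter> W)))"

definition atlas_topology :: "('a, 'e::euclidean_space) chart set \<Rightarrow> 'a topology" where
  "atlas_topology A = topology (manifold_open A)"

lemma openin_atlas_topology:
  assumes "smooth_atlas A"
  shows "openin (atlas_topology A) W \<longleftrightarrow> manifold_open A W"
proof -
  have "istopology (manifold_open A)"
    unfolding istopology_def
  proof (intro conjI allI impI)
    fix S T assume ST: "manifold_open A S" "manifold_open A T"
    have "open (snd c ` (fst c \<inter> (S \<inter> T)))" if c: "c \<in> A" for c
    proof -
      have "inj_on (snd c) (fst c)"
        using assms c by (auto simp: smooth_atlas_def)
      then have "snd c ` (fst c \<inter> (S \<inter> T)) = snd c ` (fst c \<inter> S) \<inter> snd c ` (fst c \<inter> T)"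
        by (auto simp: inj_on_def)
      then show ?thesis
        using ST c by (auto simp: manifold_open_def)
    qed
    then show "manifold_open A (S \<inter> T)"
      using ST by (auto simp: manifold_open_def)
  next
    fix K assume K: "\<forall>S\<in>K. manifold_open A S"
    have "open (snd c ` (fst c \<inter> \<Union>K))" if c: "c \<in> A" for c
    proof -
      have "snd c ` (fst c \<inter> \<Union>K) = (\<Union>S\<in>K. snd c ` (fst c \<inter> S))"
        by auto
      then show ?thesis
        using K c by (auto simp: manifold_open_def)
    qed
    then show "manifold_open A (\<Union>K)"
      using K by (auto simp: manifold_open_def)
  qed
  then show ?thesis
    by (simp add: atlas_topology_def topology_inverse')
qed

definition connected_smooth_manifold :: "('a, 'e::euclidean_space) chart set \<Rightarrow> bool" where
  "connected_smooth_manifold A \<longleftrightarrow>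
     smooth_atlas A \<and> Hausdorff_space (atlas_topology A) \<and>
     second_countable (atlas_topology A) \<and> connected_space (atlas_topology A)"

definition Ck_fun :: "('a, 'e::euclidean_space) chart set \<Rightarrow> nat \<Rightarrow> 'a set \<Rightarrow> ('a \<Rightarrow> real) \<Rightarrow> bool" where
  "Ck_fun A k W f \<longleftrightarrow> (\<forall>c\<in>A. Ck_on k (f \<circ> chart_inv c) (snd c ` (fst c \<inter> W)))"

definition smooth_fun :: "('a, 'e::euclidean_space) chart set \<Rightarrow> 'a set \<Rightarrow> ('a \<Rightarrow> real) \<Rightarrow> bool" where
  "smooth_fun A W f \<longleftrightarrow> (\<forall>k. Ck_fun A k W f)"


section \<open>Tangent vectors, vector fields and forms\<close>

text \<open>A tangent vector at \<open>p\<close> is the family of its component vectors in all charts around \<open>p\<close>, related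
  by the derivatives of the coordinate changes (and \<open>0\<close> in the charts not containing \<open>p\<close>). The vector
  space operations are those of the components, chart by chart.\<close>

type_synonym ('a, 'e) tvec = "('a, 'e) chart \<Rightarrow> 'e"

definition tangent_space :: "('a, 'e::euclidean_space) chart set \<Rightarrow> 'a \<Rightarrow> ('a, 'e) tvec set" where
  "tangent_space A p =
     {v. (\<forall>c. c \<notin> charts_at A p \<longrightarrow> v c = 0) \<and>
         (\<forall>c\<in>charts_at A p. \<forall>d\<in>charts_at A p.
            v d = frechet_derivative (snd d \<circ> chart_inv c) (at (snd c p)) (v c))}"

abbreviation tzero :: "('a, 'e::euclidean_space) tvec" where
  "tzero \<equiv> (\<lambda>_. 0)"

type_synonym ('a, 'e) vfield = "'a \<Rightarrow> ('a, 'e) tvec"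
type_synonym ('a, 'e) form1 = "'a \<Rightarrow> ('a, 'e) tvec \<Rightarrow> real"
type_synonym ('a, 'e) vform1 = "'a \<Rightarrow> ('a, 'e) tvec \<Rightarrow> ('a, 'e) tvec"

definition smooth_vfield ::
    "('a, 'e::euclidean_space) chart set \<Rightarrow> 'a set \<Rightarrow> ('a, 'e) vfield \<Rightarrow> bool" where
  "smooth_vfield A W X \<longleftrightarrow>
     (\<forall>p\<in>W. X p \<in> tangent_space A p) \<and>
     (\<forall>c\<in>A. smooth_on (\<lambda>x. X (chart_inv c x) c) (snd c ` (fst c \<inter> W)))"

definition smooth_vfield_near ::
    "('a, 'e::euclidean_space) chart set \<Rightarrow> 'a \<Rightarrow> ('a, 'e) vfield \<Rightarrow> bool" where
  "smooth_vfield_near A p X \<longleftrightarrow> (\<exists>W. manifold_open A W \<and> p \<in> W \<and> smooth_vfield A W X)"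

definition differential ::
    "('a, 'e::euclidean_space) chart set \<Rightarrow> ('a \<Rightarrow> real) \<Rightarrow> ('a, 'e) form1" where
  "differential A f p v =
     (THE r. \<forall>c\<in>charts_at A p. r = frechet_derivative (f \<circ> chart_inv c) (at (snd c p)) (v c))"

text \<open>In coordinates, \<open>[X, Y]\<^sup>i = X\<^sup>j \<partial>\<^sub>j Y\<^sup>i - Y\<^sup>j \<partial>\<^sub>j X\<^sup>i\<close>.\<close>

definition lie_bracket ::
    "('a, 'e::euclidean_space) chart set \<Rightarrow> ('a, 'e) vfield \<Rightarrow> ('a, 'e) vfield \<Rightarrow> ('a, 'e) vfield" where
  "lie_bracket A X Y p =
     (\<lambda>c. if c \<in> charts_at A p
          then frechet_derivative (\<lambda>x. Y (chart_inv c x) c) (at (snd c p)) (X p c)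
             - frechet_derivative (\<lambda>x. X (chart_inv c x) c) (at (snd c p)) (Y p c)
          else 0)"

text \<open>\<open>d\<alpha>(X, Y) = X(\<alpha>(Y)) - Y(\<alpha>(X)) - \<alpha>([X, Y])\<close>, as a tensor: the value at \<open>p\<close> on \<open>v, w\<close> is the common
  value of the right-hand side for all local fields extending \<open>v\<close> and \<open>w\<close>.\<close>

definition ext_deriv ::
    "('a, 'e::euclidean_space) chart set \<Rightarrow> ('a, 'e) form1 \<Rightarrow>
     'a \<Rightarrow> ('a, 'e) tvec \<Rightarrow> ('a, 'e) tvec \<Rightarrow> real" where
  "ext_deriv A \<alpha> p v w =
     (THE r. \<forall>X Y. smooth_vfield_near A p X \<and> smooth_vfield_near A p Y \<and> X p = v \<and> Y p = w \<longrightarrow>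
        r = differential A (\<lambda>q. \<alpha> q (Y q)) p v - differential A (\<lambda>q. \<alpha> q (X q)) p w
            - \<alpha> p (lie_bracket A X Y p))"

text \<open>\<open>d\<^sub>K f = df \<circ> K\<close>\<close>

definition d_along ::
    "('a, 'e::euclidean_space) chart set \<Rightarrow> ('a, 'e) vform1 \<Rightarrow> ('a \<Rightarrow> real) \<Rightarrow> ('a, 'e) form1" where
  "d_along A K f p v = differential A f p (K p v)"

text \<open>\<open>[K, Y]X = [KX, Y] - K[X, Y]\<close>, again as a tensor.\<close>

definition vform_bracket ::
    "('a, 'e::euclidean_space) chart set \<Rightarrow> ('a, 'e) vform1 \<Rightarrow> ('a, 'e) vfield \<Rightarrow> ('a, 'e) vform1" where
  "vform_bracket A K Y p w =
     (THE z. \<forall>X. smooth_vfield_near A p X \<and> X p = w \<longrightarrow>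
        z = (\<lambda>c. lie_bracket A (\<lambda>q. K q (X q)) Y p c - K p (lie_bracket A X Y p) c))"


section \<open>The tangent bundle\<close>

text \<open>Points of \<open>TM\<close> are pairs of a base point and a tangent vector there; a chart of \<open>M\<close> with coordinates
  \<open>x\<close> induces the chart of \<open>TM\<close> with coordinates \<open>(x, y)\<close>.\<close>

type_synonym ('a, 'e) tpoint = "'a \<times> ('a, 'e) tvec"

definition tangent_chart ::
    "('a, 'e::euclidean_space) chart set \<Rightarrow> ('a, 'e) chart \<Rightarrow> (('a, 'e) tpoint, 'e \<times> 'e) chart" where
  "tangent_chart A c =
     ({(p, v). p \<in> fst c \<and> v \<in> tangent_space A p}, \<lambda>(p, v). (snd c p, v c))"

definition tangent_atlas ::
    "('a, 'e::euclidean_space) chart set \<Rightarrow> (('a, 'e) tpoint, 'e \<times> 'e) chart set" where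
  "tangent_atlas A = tangent_chart A ` A"

definition TM :: "('a, 'e::euclidean_space) chart set \<Rightarrow> ('a, 'e) tpoint set" where
  "TM A = {(p, v). p \<in> carrier_of A \<and> v \<in> tangent_space A p}"

definition TM0 :: "('a, 'e::euclidean_space) chart set \<Rightarrow> ('a, 'e) tpoint set" where
  "TM0 A = {(p, v) \<in> TM A. v \<noteq> tzero}"

abbreviation TTM :: "('a, 'e::euclidean_space) chart set \<Rightarrow> ('a, 'e) tpoint \<Rightarrow>
    (('a, 'e) tpoint, 'e \<times> 'e) tvec set" where
  "TTM A \<equiv> tangent_space (tangent_atlas A)"

text \<open>A vector tangent to \<open>TM\<close> is vertical if the tangent map of the projection \<open>(p, v) \<mapsto> p\<close>, which is
  \<open>(x, y, a, b) \<mapsto> (x, a)\<close> in induced coordinates, annihilates it.\<close>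

definition vertical :: "(('a, 'e::euclidean_space) tpoint, 'e \<times> 'e) tvec \<Rightarrow> bool" where
  "vertical w \<longleftrightarrow> (\<forall>c. fst (w c) = 0)"

text \<open>The vertical endomorphism, \<open>J(\<partial>/\<partial>x\<^sup>i) = \<partial>/\<partial>y\<^sup>i\<close> and \<open>J(\<partial>/\<partial>y\<^sup>i) = 0\<close>.\<close>

definition J :: "(('a, 'e::euclidean_space) tpoint, 'e \<times> 'e) vform1" where
  "J p w = (\<lambda>c. (0, fst (w c)))"

text \<open>Vector 1-forms on \<open>TM\<close> are defined on all of \<open>TM\<close>, but need to be smooth only off the zero section.\<close>

definition vector_1form ::
    "('a, 'e::euclidean_space) chart set \<Rightarrow> (('a, 'e) tpoint, 'e \<times> 'e) vform1 \<Rightarrow> bool" where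
  "vector_1form A K \<longleftrightarrow>
     (\<forall>p\<in>TM A. \<forall>v\<in>TTM A p. K p v \<in> TTM A p) \<and>
     (\<forall>p\<in>TM A. \<forall>v\<in>TTM A p. \<forall>w\<in>TTM A p. \<forall>a b.
        K p (\<lambda>c. a *\<^sub>R v c + b *\<^sub>R w c) = (\<lambda>c. a *\<^sub>R K p v c + b *\<^sub>R K p w c)) \<and>
     (\<forall>W X. manifold_open (tangent_atlas A) W \<and> W \<subseteq> TM0 A \<and> smooth_vfield (tangent_atlas A) W X \<longrightarrow>
        smooth_vfield (tangent_atlas A) W (\<lambda>p. K p (X p)))"

definition semibasic ::
    "('a, 'e::euclidean_space) chart set \<Rightarrow> (('a, 'e) tpoint, 'e \<times> 'e) vform1 \<Rightarrow> bool" where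
  "semibasic A L \<longleftrightarrow> vector_1form A L \<and>
     (\<forall>p\<in>TM A. \<forall>w\<in>TTM A p. L p (J p w) = tzero \<and> J p (L p w) = tzero)"

definition Ehresmann_connection ::
    "('a, 'e::euclidean_space) chart set \<Rightarrow> (('a, 'e) tpoint, 'e \<times> 'e) vform1 \<Rightarrow> bool" where
  "Ehresmann_connection A h \<longleftrightarrow> vector_1form A h \<and>
     (\<forall>p\<in>TM A. \<forall>w\<in>TTM A p. h p (h p w) = h p w \<and> (h p w = tzero \<longleftrightarrow> vertical w))"


section \<open>Finsler manifolds\<close>

definition fundamental_form ::
    "('a, 'e::euclidean_space) chart set \<Rightarrow> (('a, 'e) tpoint \<Rightarrow> real) \<Rightarrow> ('a, 'e) tpoint \<Rightarrow>
     (('a, 'e) tpoint, 'e \<times> 'e) tvec \<Rightarrow> (('a, 'e) tpoint, 'e \<times> 'e) tvec \<Rightarrow> real" where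
  "fundamental_form A E = ext_deriv (tangent_atlas A) (d_along (tangent_atlas A) J E)"

definition Finsler_manifold ::
    "('a, 'e::euclidean_space) chart set \<Rightarrow> (('a, 'e) tpoint \<Rightarrow> real) \<Rightarrow> bool" where
  "Finsler_manifold A E \<longleftrightarrow>
     connected_smooth_manifold A \<and>
     (\<forall>p\<in>carrier_of A. E (p, tzero) = 0) \<and>
     (\<forall>q\<in>TM0 A. E q > 0) \<and>
     Ck_fun (tangent_atlas A) 1 (TM A) E \<and>
     smooth_fun (tangent_atlas A) (TM0 A) E \<and>
     (\<forall>(p, v)\<in>TM A. \<forall>t>0. E (p, \<lambda>c. t *\<^sub>R v c) = t\<^sup>2 * E (p, v)) \<and>
     (\<forall>q\<in>TM0 A. \<forall>v\<in>TTM A q. (\<forall>w\<in>TTM A q. fundamental_form A E q v w = 0) \<longrightarrow> v = tzero)"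

text \<open>\<open>i\<^sub>X \<omega> = \<beta>\<close> with \<open>(i\<^sub>X \<omega>)(Y) = \<omega>(X, Y)\<close>. On the zero section, where \<open>\<omega>\<close> is not available, the value
  is set to \<open>0\<close>; in particular the canonical spray vanishes there.\<close>

definition sharp ::
    "('a, 'e::euclidean_space) chart set \<Rightarrow> (('a, 'e) tpoint \<Rightarrow> real) \<Rightarrow>
     (('a, 'e) tpoint, 'e \<times> 'e) form1 \<Rightarrow> (('a, 'e) tpoint, 'e \<times> 'e) vfield" where
  "sharp A E \<beta> q =
     (if q \<in> TM0 A
      then THE v. v \<in> TTM A q \<and> (\<forall>w\<in>TTM A q. fundamental_form A E q v w = \<beta> q w)
      else tzero)"

definition canonical_spray ::
    "('a, 'e::euclidean_space) chart set \<Rightarrow> (('a, 'e) tpoint \<Rightarrow> real) \<Rightarrow>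
     (('a, 'e) tpoint, 'e \<times> 'e) vfield" where
  "canonical_spray A E q = (\<lambda>c. - sharp A E (differential (tangent_atlas A) E) q c)"

definition Berwald_connection ::
    "('a, 'e::euclidean_space) chart set \<Rightarrow> (('a, 'e) tpoint \<Rightarrow> real) \<Rightarrow>
     (('a, 'e) tpoint, 'e \<times> 'e) vform1" where
  "Berwald_connection A E q w =
     (\<lambda>c. (1/2) *\<^sub>R (w c + vform_bracket (tangent_atlas A) J (canonical_spray A E) q w c))"

definition conservative_connection ::
    "('a, 'e::euclidean_space) chart set \<Rightarrow> (('a, 'e) tpoint \<Rightarrow> real) \<Rightarrow>
     (('a, 'e) tpoint, 'e \<times> 'e) vform1 \<Rightarrow> bool" where
  "conservative_connection A E h \<longleftrightarrow> Ehresmann_connection A h \<and>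
     (\<forall>q\<in>TM A. \<forall>w\<in>TTM A q. d_along (tangent_atlas A) h E q w = 0)"

definition conservative_semibasic ::
    "('a, 'e::euclidean_space) chart set \<Rightarrow> (('a, 'e) tpoint \<Rightarrow> real) \<Rightarrow>
     (('a, 'e) tpoint, 'e \<times> 'e) vform1 \<Rightarrow> bool" where
  "conservative_semibasic A E L \<longleftrightarrow> semibasic A L \<and>
     (\<exists>h1 h2. conservative_connection A E h1 \<and> conservative_connection A E h2 \<and>
        (\<forall>q\<in>TM A. \<forall>w\<in>TTM A q. L q w = (\<lambda>c. h1 q w c - h2 q w c)))"

text \<open>\<open>h\<^sub>L = h\<^sub>0 + L + [J, (d\<^sub>L E)\<^sup>#]\<close>\<close>

definition L_connection ::
    "('a, 'e::euclidean_space) chart set \<Rightarrow> (('a, 'e) tpoint \<Rightarrow> real) \<Rightarrow>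
     (('a, 'e) tpoint, 'e \<times> 'e) vform1 \<Rightarrow> (('a, 'e) tpoint, 'e \<times> 'e) vform1" where
  "L_connection A E L q w =
     (\<lambda>c. Berwald_connection A E q w c + L q w c
        + vform_bracket (tangent_atlas A) J (sharp A E (d_along (tangent_atlas A) L E)) q w c)"

end

theory Submission
  imports Defs
begin

text \<open>
  Why the theorem is true. A conservative semibasic form \<open>L\<close> is a difference of two connections that annihilate \<open>E\<close>,
  so \<open>d\<^sub>L E = 0\<close>. Nondegeneracy of \<open>\<omega>\<close> gives \<open>(d\<^sub>L E)\<^sup># = 0\<close>, hence the bracket of \<open>J\<close> with it vanishes and
  \<open>h\<^sub>L = h\<^sub>0 + L\<close> (\<open>L_connection_eq\<close>). Since \<open>dE \<circ> L = 0\<close>, everything rests on the Berwald connection \<open>h\<^sub>0\<close>: it has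
  to be conservative, and adding \<open>L\<close> must leave an Ehresmann connection.

  Both are coordinate computations on \<open>TM\<close>. Write \<open>(x, y)\<close> for induced coordinates, \<open>e\<close> for the energy, \<open>H\<close> for its
  second derivative, \<open>J (a, b) = (0, a)\<close> and \<open>C = (0, y)\<close>. Then \<open>\<omega>(v, w) = H(v, J w) - H(w, J v)\<close>, and the spray \<open>S\<close>
  is the solution of \<open>\<omega>(S, w) = - de(w)\<close>. Euler's relation \<open>de(C) = 2 e\<close> and its derivative
  \<open>H(u, C) = 2 de(u) - de(0, snd u)\<close> imply successively
  \<open>J S = C\<close>, so that \<open>S = (y, g)\<close> (\<open>fst_spray\<close>), and \<open>H(S, (0, a)) = de(a, 0)\<close> (\<open>hess_spray_vertical\<close>). The
  antisymmetry of \<open>\<omega>\<close> gives \<open>de(S) = 0\<close>. Differentiating the latter in the direction \<open>(0, a)\<close> yields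
  \<open>de(DS(0, a)) = - de(a, 0)\<close> (\<open>FD_e_FD_spray_vertical\<close>). As \<open>J\<close> has constant components,
  \<open>[J, S] w = DS(J w) - J(DS w)\<close>, and therefore \<open>2 h\<^sub>0 (a, b) = (a, b) + DS(0, a) - (0, b)\<close>; by the previous
  identity \<open>de\<close> vanishes on it (\<open>Berwald_identity\<close>). The first component of \<open>h\<^sub>0 (a, b)\<close> is \<open>a\<close>, and \<open>h\<^sub>0 (a, b)\<close> depends on \<open>a\<close>
  only, so that \<open>h\<^sub>0\<close> is a projection with the vertical vectors as kernel. The form \<open>L\<close> kills vertical vectors and has
  vertical values, so \<open>h\<^sub>0 + L\<close> is such a projection as well.

  Three points need more than this algebra. First, the connection must be smooth off the zero section: \<open>S\<close> solves a linear
  system with smooth coefficients, and implicit differentiation shows that solutions of such systems are of class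
  \<open>C\<^sup>k\<close> for every \<open>k\<close> (\<open>Ck_on_linear_system\<close>). Second, on the zero section \<open>\<omega>\<close> is not available.
  There \<open>g\<close> is homogeneous of degree \<open>2\<close> and bounded on compact pieces of the sphere bundle, hence \<open>O(|y|\<^sup>2)\<close>; so \<open>S\<close>
  is differentiable (\<open>spray_has_derivative_zero_section\<close>) and \<open>h\<^sub>0\<close> is still given by the formula above, while \<open>dE = 0\<close> because
  \<open>E\<close> has a minimum there. Third, the values of \<open>h\<^sub>0\<close> are tangent vectors, i.e. transform correctly between charts: this
  is the invariance of the Lie bracket for fields that are merely differentiable at a point
  (\<open>lie_bracket_in_tangent_space\<close>), which comes down to the symmetry of second derivatives.
\<close>

section \<open>Calculus of maps of class \<open>C\<^sup>k\<close>\<close>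

abbreviation FD :: "('a::real_normed_vector \<Rightarrow> 'b::real_normed_vector) \<Rightarrow> 'a \<Rightarrow> 'a \<Rightarrow> 'b" where
  "FD f x \<equiv> frechet_derivative f (at x)"

lemma FD_works: "f differentiable at x \<Longrightarrow> (f has_derivative FD f x) (at x)"
  using frechet_derivative_works by blast

lemma FD_eq: "(f has_derivative f') (at x) \<Longrightarrow> FD f x = f'"
  using frechet_derivative_at by metis

lemma bounded_linear_FD: "f differentiable at x \<Longrightarrow> bounded_linear (FD f x)"
  using FD_works has_derivative_bounded_linear by blast

lemma FD_cong:
  assumes "open S" "x \<in> S" "\<And>y. y \<in> S \<Longrightarrow> f y = g y"
  shows "FD f x = FD g x"
proof (cases "f differentiable at x")
  case True
  then show ?thesis
    using assms frechet_derivative_transform_within_open by blast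
next
  case False
  have "(f has_derivative F) (at x) = (g has_derivative F) (at x)" for F
    using assms by (metis has_derivative_transform_within_open)
  then show ?thesis
    by (simp add: frechet_derivative_def)
qed

text \<open>The class \<open>C\<^sup>k\<close> is defined by derivatives in constant directions, whereas the chain rule produces
  derivatives in moving directions; expanding the direction in a basis reduces the latter to the former.\<close>

lemma FD_Basis_expansion:
  fixes f :: "'a::euclidean_space \<Rightarrow> 'b::real_normed_vector"
  assumes "f differentiable at x"
  shows "FD f x v = (\<Sum>b\<in>Basis. (v \<bullet> b) *\<^sub>R FD f x b)"
proof -
  interpret bounded_linear "FD f x"
    using assms by (rule bounded_linear_FD)
  have "FD f x (\<Sum>b\<in>Basis. (v \<bullet> b) *\<^sub>R b) = (\<Sum>b\<in>Basis. (v \<bullet> b) *\<^sub>R FD f x b)"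
    by (simp add: sum scaleR)
  then show ?thesis
    by (simp add: euclidean_representation)
qed

lemma Ck_on_cong:
  assumes "open S" "\<And>x. x \<in> S \<Longrightarrow> f x = g x" "Ck_on k f S"
  shows "Ck_on k g S"
  using assms(2,3)
proof (induction k arbitrary: f g)
  case 0
  then show ?case
    using continuous_on_cong by (metis Ck_on.simps(1))
next
  case (Suc k)
  have "FD f x = FD g x" if "x \<in> S" for x
    using FD_cong[OF assms(1) that] Suc.prems(1) by blast
  moreover have "g differentiable at x" if "x \<in> S" for x
    using Suc.prems that assms(1) unfolding Ck_on.simps differentiable_def
    by (metis has_derivative_transform_within_open)
  ultimately show ?case
    using Suc.prems(2) Suc.IH by (metis (no_types, lifting) Ck_on.simps(2))
qed

text \<open>In an induction over \<open>k\<close> it suffices to exhibit the derivative in closed form.\<close>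

lemma Ck_on_SucI:
  assumes "open S" "\<And>x. x \<in> S \<Longrightarrow> (f has_derivative F x) (at x)"
    and "\<And>v. Ck_on k (\<lambda>x. F x v) S"
  shows "Ck_on (Suc k) f S"
  unfolding Ck_on.simps
proof (intro conjI ballI allI)
  show "f differentiable at x" if "x \<in> S" for x
    using assms(2) that differentiable_def by blast
  show "Ck_on k (\<lambda>x. FD f x v) S" for v
    by (rule Ck_on_cong[OF assms(1) _ assms(3)[of v]]) (simp add: FD_eq[OF assms(2)])
qed

lemma Ck_on_SucD: "Ck_on (Suc k) f S \<Longrightarrow> Ck_on k f S"
proof (induction k arbitrary: f)
  case 0
  then show ?case
    by (auto intro!: continuous_at_imp_continuous_on differentiable_imp_continuous_within)
next
  case (Suc k)
  then show ?case
    by (metis Ck_on.simps(2))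
qed

lemma Ck_on_imp_continuous_on: "Ck_on k f S \<Longrightarrow> continuous_on S f"
  by (induction k) (use Ck_on.simps(1) Ck_on_SucD in blast)+

lemma Ck_on_const: "Ck_on k (\<lambda>_. c) S"
  by (induction k arbitrary: c) auto

lemma Ck_on_id: "Ck_on k (\<lambda>x. x) S"
  by (cases k) (auto simp: Ck_on_const)

lemma Ck_on_bounded_linear:
  assumes "open S" "bounded_linear h" "Ck_on k f S"
  shows "Ck_on k (\<lambda>x. h (f x)) S"
  using assms(3)
proof (induction k arbitrary: f)
  case 0
  then show ?case
    using bounded_linear.continuous_on[OF assms(2)] by auto
next
  case (Suc k)
  show ?case
  proof (rule Ck_on_SucI[OF assms(1)])
    show "((\<lambda>x. h (f x)) has_derivative (\<lambda>v. h (FD f x v))) (at x)" if "x \<in> S" for x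
      using bounded_linear.has_derivative[OF assms(2) FD_works] Suc.prems that by auto
    show "Ck_on k (\<lambda>x. h (FD f x v)) S" for v
      using Suc by auto
  qed
qed

lemma Ck_on_add:
  assumes "open S" "Ck_on k f S" "Ck_on k g S"
  shows "Ck_on k (\<lambda>x. f x + g x) S"
  using assms(2,3)
proof (induction k arbitrary: f g)
  case 0
  then show ?case
    by (auto intro: continuous_on_add)
next
  case (Suc k)
  show ?case
  proof (rule Ck_on_SucI[OF assms(1)])
    show "((\<lambda>x. f x + g x) has_derivative (\<lambda>v. FD f x v + FD g x v)) (at x)" if "x \<in> S" for x
      using Suc.prems that by (intro has_derivative_add FD_works) auto
    show "Ck_on k (\<lambda>x. FD f x v + FD g x v) S" for v
      using Suc by auto
  qed
qed

lemma Ck_on_sum: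
  assumes "open S" "\<And>i. i \<in> I \<Longrightarrow> Ck_on k (f i) S"
  shows "Ck_on k (\<lambda>x. \<Sum>i\<in>I. f i x) S"
  using assms(2)
  by (induction I rule: infinite_finite_induct) (auto simp: Ck_on_const intro!: Ck_on_add assms(1))

lemma Ck_on_bilinear:
  assumes "open S" "bounded_bilinear h" "Ck_on k f S" "Ck_on k g S"
  shows "Ck_on k (\<lambda>x. h (f x) (g x)) S"
  using assms(3,4)
proof (induction k arbitrary: f g)
  case 0
  then show ?case
    using bounded_bilinear.continuous_on[OF assms(2)] by auto
next
  case (Suc k)
  show ?case
  proof (rule Ck_on_SucI[OF assms(1)])
    show "((\<lambda>x. h (f x) (g x)) has_derivative
        (\<lambda>v. h (f x) (FD g x v) + h (FD f x v) (g x))) (at x)" if "x \<in> S" for x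
      using Suc.prems that by (intro bounded_bilinear.FDERIV[OF assms(2)] FD_works) auto
    have "Ck_on k f S" "Ck_on k g S"
      using Suc.prems Ck_on_SucD by blast+
    then show "Ck_on k (\<lambda>x. h (f x) (FD g x v) + h (FD f x v) (g x)) S" for v
      using Suc by (auto intro!: Ck_on_add assms(1))
  qed
qed

lemma Ck_on_compose:
  fixes g :: "'a::real_normed_vector \<Rightarrow> 'b::euclidean_space"
    and f :: "'b \<Rightarrow> 'c::real_normed_vector"
  assumes "open S" "Ck_on k f T" "Ck_on k g S" "g ` S \<subseteq> T"
  shows "Ck_on k (\<lambda>x. f (g x)) S"
  using assms(2,3)
proof (induction k arbitrary: f)
  case 0
  then show ?case
    using assms(4) by (auto intro: continuous_on_compose2)
next
  case (Suc k)
  have df: "f differentiable at (g x)" if "x \<in> S" for x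
    using Suc.prems(1) assms(4) that by auto
  show ?case
  proof (rule Ck_on_SucI[OF assms(1)])
    show "((\<lambda>x. f (g x)) has_derivative
        (\<lambda>v. \<Sum>b\<in>Basis. (FD g x v \<bullet> b) *\<^sub>R FD f (g x) b)) (at x)" if "x \<in> S" for x
    proof -
      have "((\<lambda>x. f (g x)) has_derivative (\<lambda>v. FD f (g x) (FD g x v))) (at x)"
      proof (rule has_derivative_compose[where f = g and g = f])
        show "(g has_derivative FD g x) (at x)"
          using Suc.prems(2) that by (intro FD_works) (simp add: Ck_on.simps(2))
        show "(f has_derivative FD f (g x)) (at (g x))"
          by (rule FD_works[OF df[OF that]])
      qed
      moreover have "FD f (g x) (FD g x v) = (\<Sum>b\<in>Basis. (FD g x v \<bullet> b) *\<^sub>R FD f (g x) b)" for v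
        by (rule FD_Basis_expansion[OF df[OF that]])
      ultimately show ?thesis
        by (simp only:)
    qed
    have "Ck_on k g S"
      using Suc.prems(2) Ck_on_SucD by blast
    then show "Ck_on k (\<lambda>x. \<Sum>b\<in>Basis. (FD g x v \<bullet> b) *\<^sub>R FD f (g x) b) S" for v
      using Suc
      by (intro Ck_on_sum Ck_on_bilinear[OF _ bounded_bilinear_scaleR]
            Ck_on_bounded_linear[OF _ bounded_linear_inner_left] assms(1)) auto
  qed
qed

lemma smooth_on_cong: "open S \<Longrightarrow> (\<And>x. x \<in> S \<Longrightarrow> f x = g x) \<Longrightarrow> smooth_on f S \<Longrightarrow> smooth_on g S"
  unfolding smooth_on_def using Ck_on_cong by blast

lemma smooth_on_const: "smooth_on (\<lambda>_. c) S"
  unfolding smooth_on_def using Ck_on_const by blast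

lemma smooth_on_id: "smooth_on (\<lambda>x. x) S"
  unfolding smooth_on_def using Ck_on_id by blast

lemma smooth_on_bounded_linear:
  "open S \<Longrightarrow> bounded_linear h \<Longrightarrow> smooth_on f S \<Longrightarrow> smooth_on (\<lambda>x. h (f x)) S"
  unfolding smooth_on_def using Ck_on_bounded_linear by blast

lemma smooth_on_add: "open S \<Longrightarrow> smooth_on f S \<Longrightarrow> smooth_on g S \<Longrightarrow> smooth_on (\<lambda>x. f x + g x) S"
  unfolding smooth_on_def using Ck_on_add by blast

lemma smooth_on_sum:
  "open S \<Longrightarrow> (\<And>i. i \<in> I \<Longrightarrow> smooth_on (f i) S) \<Longrightarrow> smooth_on (\<lambda>x. \<Sum>i\<in>I. f i x) S"
  unfolding smooth_on_def using Ck_on_sum[of S I] by blast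

lemma smooth_on_bilinear:
  "open S \<Longrightarrow> bounded_bilinear h \<Longrightarrow> smooth_on f S \<Longrightarrow> smooth_on g S \<Longrightarrow>
   smooth_on (\<lambda>x. h (f x) (g x)) S"
  unfolding smooth_on_def using Ck_on_bilinear by blast

lemma smooth_on_compose:
  fixes g :: "'a::real_normed_vector \<Rightarrow> 'b::euclidean_space"
  shows "open S \<Longrightarrow> smooth_on f T \<Longrightarrow> smooth_on g S \<Longrightarrow> g ` S \<subseteq> T \<Longrightarrow> smooth_on (\<lambda>x. f (g x)) S"
  unfolding smooth_on_def using Ck_on_compose by blast

lemma smooth_on_imp_differentiable: "smooth_on f S \<Longrightarrow> x \<in> S \<Longrightarrow> f differentiable at x"
  unfolding smooth_on_def using Ck_on.simps(2) by blast

lemma smooth_on_FD: "smooth_on f S \<Longrightarrow> smooth_on (\<lambda>x. FD f x v) S"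
  unfolding smooth_on_def by (metis Ck_on.simps(2))

lemma smooth_on_minus: "open S \<Longrightarrow> smooth_on f S \<Longrightarrow> smooth_on (\<lambda>x. - f x) S"
  by (rule smooth_on_bounded_linear[OF _ bounded_linear_minus[OF bounded_linear_ident]])

lemma smooth_on_diff: "open S \<Longrightarrow> smooth_on f S \<Longrightarrow> smooth_on g S \<Longrightarrow> smooth_on (\<lambda>x. f x - g x) S"
  using smooth_on_add[OF _ _ smooth_on_minus, of S f g] by simp

lemma smooth_on_Pair:
  assumes "open S" "smooth_on f S" "smooth_on g S"
  shows "smooth_on (\<lambda>x. (f x, g x)) S"
proof -
  have "smooth_on (\<lambda>x. (f x, 0) + (0, g x)) S"
    using assms by (intro smooth_on_add
      smooth_on_bounded_linear[OF _ bounded_linear_Pair[OF bounded_linear_ident bounded_linear_zero]]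
      smooth_on_bounded_linear[OF _ bounded_linear_Pair[OF bounded_linear_zero bounded_linear_ident]])
  then show ?thesis by simp
qed

lemma smooth_on_FD_apply:
  fixes f :: "'b::euclidean_space \<Rightarrow> 'c::real_normed_vector"
  assumes "open S" "smooth_on f T" "smooth_on g S" "g ` S \<subseteq> T" "smooth_on u S"
  shows "smooth_on (\<lambda>x. FD f (g x) (u x)) S"
proof -
  have "smooth_on (\<lambda>x. \<Sum>b\<in>Basis. (u x \<bullet> b) *\<^sub>R FD f (g x) b) S"
    using assms by (intro smooth_on_sum smooth_on_bilinear[OF _ bounded_bilinear_scaleR]
      smooth_on_bounded_linear[OF _ bounded_linear_inner_left]
      smooth_on_compose[OF _ smooth_on_FD])
  then show ?thesis
  proof (rule smooth_on_cong[OF assms(1), rotated])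
    fix x assume "x \<in> S"
    then have "f differentiable at (g x)"
      using assms by (intro smooth_on_imp_differentiable[OF assms(2)]) auto
    then show "(\<Sum>b\<in>Basis. (u x \<bullet> b) *\<^sub>R FD f (g x) b) = FD f (g x) (u x)"
      by (rule FD_Basis_expansion[symmetric])
  qed
qed

text \<open>The product rule for the pairing of the derivative with a moving vector: the second summand on the
  right is the second derivative. Every differentiation below of an expression like \<open>dE(X)\<close> in a chart
  is an instance.\<close>

lemma has_derivative_FD_apply:
  fixes f :: "'a::euclidean_space \<Rightarrow> 'b::real_normed_vector"
  assumes "open S" "x \<in> S" "smooth_on f S" "g differentiable at x"
  shows "((\<lambda>y. FD f y (g y)) has_derivative (\<lambda>u. FD f x (FD g x u) + FD (\<lambda>y. FD f y (g x)) x u)) (at x)"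
proof -
  have expand: "FD f y w = (\<Sum>b\<in>Basis. (w \<bullet> b) *\<^sub>R FD f y b)" if "y \<in> S" for y w
    by (rule FD_Basis_expansion[OF smooth_on_imp_differentiable[OF assms(3) that]])
  have d: "((\<lambda>y. FD f y w) has_derivative FD (\<lambda>y. FD f y w) x) (at x)" for w
    by (rule FD_works[OF smooth_on_imp_differentiable[OF smooth_on_FD[OF assms(3)] assms(2)]])
  have "((\<lambda>y. \<Sum>b\<in>Basis. (g y \<bullet> b) *\<^sub>R FD f y b) has_derivative
      (\<lambda>u. \<Sum>b\<in>Basis. (g x \<bullet> b) *\<^sub>R FD (\<lambda>y. FD f y b) x u + (FD g x u \<bullet> b) *\<^sub>R FD f x b)) (at x)"
    by (intro has_derivative_sum has_derivative_scaleR has_derivative_inner_left FD_works[OF assms(4)] d)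
  moreover have "(\<Sum>b\<in>Basis. (g x \<bullet> b) *\<^sub>R FD (\<lambda>y. FD f y b) x u + (FD g x u \<bullet> b) *\<^sub>R FD f x b)
      = FD f x (FD g x u) + FD (\<lambda>y. FD f y (g x)) x u" for u
  proof -
    have "((\<lambda>y. \<Sum>b\<in>Basis. (g x \<bullet> b) *\<^sub>R FD f y b) has_derivative
        (\<lambda>u. \<Sum>b\<in>Basis. (g x \<bullet> b) *\<^sub>R FD (\<lambda>y. FD f y b) x u)) (at x)"
      by (intro has_derivative_sum has_derivative_scaleR_right d)
    then have "((\<lambda>y. FD f y (g x)) has_derivative
        (\<lambda>u. \<Sum>b\<in>Basis. (g x \<bullet> b) *\<^sub>R FD (\<lambda>y. FD f y b) x u)) (at x)"
      by (rule has_derivative_transform_within_open[OF _ assms(1,2)]) (rule expand[symmetric])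
    then have "FD (\<lambda>y. FD f y (g x)) x u = (\<Sum>b\<in>Basis. (g x \<bullet> b) *\<^sub>R FD (\<lambda>y. FD f y b) x u)"
      by (simp add: FD_eq)
    then show ?thesis
      by (simp add: sum.distrib expand[OF assms(2), symmetric])
  qed
  ultimately have "((\<lambda>y. \<Sum>b\<in>Basis. (g y \<bullet> b) *\<^sub>R FD f y b) has_derivative
      (\<lambda>u. FD f x (FD g x u) + FD (\<lambda>y. FD f y (g x)) x u)) (at x)"
    by (simp only:)
  then show ?thesis
    by (rule has_derivative_transform_within_open[OF _ assms(1,2)]) (rule expand[symmetric])
qed

section \<open>Symmetry of second derivatives\<close>

text \<open>The curve \<open>c\<close> is meant to be a line with direction \<open>w\<close>, on which the mean value theorem is applied.\<close>

lemma has_real_derivative_along_line: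
  fixes g :: "'a::real_normed_vector \<Rightarrow> real"
  assumes "(c has_derivative (\<lambda>h. h *\<^sub>R w)) (at t)" "g differentiable at (c t)"
  shows "((\<lambda>t. g (c t)) has_real_derivative FD g (c t) w) (at t)"
proof -
  have "((\<lambda>t. g (c t)) has_derivative (\<lambda>h. FD g (c t) (h *\<^sub>R w))) (at t)"
    using has_derivative_compose[OF assms(1) FD_works[OF assms(2)]] .
  moreover have "FD g (c t) (h *\<^sub>R w) = FD g (c t) w * h" for h
    using linear_scale[OF bounded_linear.linear[OF bounded_linear_FD[OF assms(2)]]] by simp
  ultimately show ?thesis
    by (simp add: has_field_derivative_def)
qed

text \<open>Two applications of the mean value theorem, first in the direction \<open>u\<close> and then in the direction \<open>v\<close>.
  The left-hand side is symmetric in \<open>u\<close> and \<open>v\<close>, which forces the symmetry of the second derivative.\<close>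

lemma second_difference_mean_value:
  fixes f :: "'a::real_normed_vector \<Rightarrow> real"
  assumes "open S" "Ck_on 2 f S" "s > 0"
    and box: "\<And>a b. 0 \<le> a \<Longrightarrow> a \<le> s \<Longrightarrow> 0 \<le> b \<Longrightarrow> b \<le> s \<Longrightarrow> x + a *\<^sub>R u + b *\<^sub>R v \<in> S"
  obtains a b where "0 \<le> a" "a \<le> s" "0 \<le> b" "b \<le> s"
    "f (x + s *\<^sub>R u + s *\<^sub>R v) - f (x + s *\<^sub>R u) - f (x + s *\<^sub>R v) + f x
       = s * s * FD (\<lambda>z. FD f z u) (x + a *\<^sub>R u + b *\<^sub>R v) v"
proof -
  have ck: "Ck_on (Suc (Suc 0)) f S"
    using assms(2) by (simp only: numeral_2_eq_2)
  have d1: "f differentiable at z" if "z \<in> S" for z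
    using ck that by auto
  have d2: "(\<lambda>z. FD f z u) differentiable at z" if "z \<in> S" for z
    using ck that by auto
  have i1: "((\<lambda>a. x + a *\<^sub>R u + b *\<^sub>R v) has_derivative (\<lambda>h. h *\<^sub>R u)) (at a)" for a b
    by (auto intro!: derivative_eq_intros)
  have i2: "((\<lambda>b. x + a *\<^sub>R u + b *\<^sub>R v) has_derivative (\<lambda>h. h *\<^sub>R v)) (at b)" for a b
    by (auto intro!: derivative_eq_intros)
  have c1: "((\<lambda>a. f (x + a *\<^sub>R u + b *\<^sub>R v)) has_real_derivative FD f (x + a *\<^sub>R u + b *\<^sub>R v) u) (at a)"
    if "0 \<le> a" "a \<le> s" "0 \<le> b" "b \<le> s" for a b
    using has_real_derivative_along_line[OF i1 d1[OF box[OF that]]] .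
  have c2: "((\<lambda>b. FD f (x + a *\<^sub>R u + b *\<^sub>R v) u) has_real_derivative
      FD (\<lambda>z. FD f z u) (x + a *\<^sub>R u + b *\<^sub>R v) v) (at b)"
    if "0 \<le> a" "a \<le> s" "0 \<le> b" "b \<le> s" for a b
    using has_real_derivative_along_line[OF i2 d2[OF box[OF that]]] .
  have "\<exists>a>0. a < s \<and>
    (f (x + s *\<^sub>R u + s *\<^sub>R v) - f (x + s *\<^sub>R u + 0 *\<^sub>R v)) - (f (x + 0 *\<^sub>R u + s *\<^sub>R v) - f (x + 0 *\<^sub>R u + 0 *\<^sub>R v))
      = (s - 0) * (FD f (x + a *\<^sub>R u + s *\<^sub>R v) u - FD f (x + a *\<^sub>R u + 0 *\<^sub>R v) u)"
    using \<open>s > 0\<close> by (intro MVT2 DERIV_diff c1) auto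
  then obtain a where a: "a > 0" "a < s"
    "f (x + s *\<^sub>R u + s *\<^sub>R v) - f (x + s *\<^sub>R u) - f (x + s *\<^sub>R v) + f x
      = s * (FD f (x + a *\<^sub>R u + s *\<^sub>R v) u - FD f (x + a *\<^sub>R u + 0 *\<^sub>R v) u)"
    by auto
  have "\<exists>b>0. b < s \<and> FD f (x + a *\<^sub>R u + s *\<^sub>R v) u - FD f (x + a *\<^sub>R u + 0 *\<^sub>R v) u
      = (s - 0) * FD (\<lambda>z. FD f z u) (x + a *\<^sub>R u + b *\<^sub>R v) v"
    using \<open>s > 0\<close> a(1,2) by (intro MVT2 c2) auto
  then obtain b where b: "b > 0" "b < s"
    "FD f (x + a *\<^sub>R u + s *\<^sub>R v) u - FD f (x + a *\<^sub>R u + 0 *\<^sub>R v) u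
      = s * FD (\<lambda>z. FD f z u) (x + a *\<^sub>R u + b *\<^sub>R v) v"
    by auto
  show ?thesis
    using that[of a b] a b by (simp add: mult.assoc)
qed

text \<open>If the two mixed derivatives differed at \<open>x\<close>, by continuity they would differ on a neighbourhood; but both
  represent the same second difference of a small parallelogram at suitable points of it.\<close>

lemma symmetric_second_derivative_real:
  fixes f :: "'a::real_normed_vector \<Rightarrow> real"
  assumes "open S" "Ck_on 2 f S" "x \<in> S"
  shows "FD (\<lambda>z. FD f z u) x v = FD (\<lambda>z. FD f z v) x u"
proof (rule ccontr)
  let ?P = "\<lambda>z. FD (\<lambda>z. FD f z u) z v" and ?Q = "\<lambda>z. FD (\<lambda>z. FD f z v) z u"
  assume ne: "?P x \<noteq> ?Q x"
  define r where "r = \<bar>?P x - ?Q x\<bar> / 2"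
  have r: "r > 0" using ne by (simp add: r_def)
  have "continuous_on S ?P" "continuous_on S ?Q"
    using assms(2) by (simp_all add: numeral_2_eq_2)
  then have "isCont ?P x" "isCont ?Q x"
    using assms by (auto simp: continuous_on_eq_continuous_at)
  then obtain d1 d2 where d: "d1 > 0" "\<And>z. dist z x < d1 \<Longrightarrow> dist (?P z) (?P x) < r"
     "d2 > 0" "\<And>z. dist z x < d2 \<Longrightarrow> dist (?Q z) (?Q x) < r"
    using r unfolding continuous_at_eps_delta by metis
  obtain d3 where d3: "d3 > 0" "ball x d3 \<subseteq> S"
    using assms open_contains_ball by blast
  define d where "d = min d1 (min d2 d3)"
  \<comment> \<open>small enough for the parallelogram spanned by \<open>s u\<close> and \<open>s v\<close> to lie in the ball of radius \<open>d\<close>; the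
    summand \<open>1\<close> avoids a zero denominator\<close>
  define s where "s = d / (2 * (norm u + norm v + 1))"
  have dpos: "d > 0" using d d3 by (simp add: d_def)
  have s: "s > 0" using dpos by (simp add: s_def add_nonneg_pos)
  have near: "dist (x + a *\<^sub>R u + b *\<^sub>R v) x < d" if "0 \<le> a" "a \<le> s" "0 \<le> b" "b \<le> s" for a b
  proof -
    have "dist (x + a *\<^sub>R u + b *\<^sub>R v) x \<le> a * norm u + b * norm v"
      using that norm_triangle_ineq[of "a *\<^sub>R u" "b *\<^sub>R v"] by (simp add: dist_norm)
    also have "\<dots> \<le> s * norm u + s * norm v"
      using that by (intro add_mono mult_right_mono) auto
    also have "\<dots> \<le> s * (norm u + norm v + 1)"
      using s by (simp add: algebra_simps)
    also have "\<dots> = d / 2"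
    proof -
      have "norm u + norm v + 1 \<noteq> 0"
        by (smt (verit) norm_ge_zero)
      then show ?thesis by (simp add: s_def field_simps)
    qed
    finally show ?thesis using dpos by simp
  qed
  have inS: "x + a *\<^sub>R u + b *\<^sub>R v \<in> S" if "0 \<le> a" "a \<le> s" "0 \<le> b" "b \<le> s" for a b
    using near[OF that] d3 by (auto simp: d_def dist_commute)
  have inS': "x + a *\<^sub>R v + b *\<^sub>R u \<in> S" if "0 \<le> a" "a \<le> s" "0 \<le> b" "b \<le> s" for a b
    using inS[OF that(3,4,1,2)] by (simp add: add_ac)
  obtain a b where ab: "0 \<le> a" "a \<le> s" "0 \<le> b" "b \<le> s"
    "f (x + s *\<^sub>R u + s *\<^sub>R v) - f (x + s *\<^sub>R u) - f (x + s *\<^sub>R v) + f x = s * s * ?P (x + a *\<^sub>R u + b *\<^sub>R v)"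
    using second_difference_mean_value[OF assms(1,2) s inS] by blast
  obtain a' b' where ab': "0 \<le> a'" "a' \<le> s" "0 \<le> b'" "b' \<le> s"
    "f (x + s *\<^sub>R v + s *\<^sub>R u) - f (x + s *\<^sub>R v) - f (x + s *\<^sub>R u) + f x = s * s * ?Q (x + a' *\<^sub>R v + b' *\<^sub>R u)"
    using second_difference_mean_value[OF assms(1,2) s inS'] by blast
  have "s * s * ?P (x + a *\<^sub>R u + b *\<^sub>R v) = s * s * ?Q (x + a' *\<^sub>R v + b' *\<^sub>R u)"
  proof -
    have eq: "x + s *\<^sub>R v + s *\<^sub>R u = x + s *\<^sub>R u + s *\<^sub>R v"
      by (simp add: add_ac)
    show ?thesis
      using ab(5) ab'(5)[unfolded eq] by linarith
  qed
  then have "?P (x + a *\<^sub>R u + b *\<^sub>R v) = ?Q (x + a' *\<^sub>R v + b' *\<^sub>R u)"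
    using s by simp
  moreover have "dist (?P (x + a *\<^sub>R u + b *\<^sub>R v)) (?P x) < r"
    using near[OF ab(1-4)] by (intro d) (simp add: d_def)
  moreover have "dist (?Q (x + a' *\<^sub>R v + b' *\<^sub>R u)) (?Q x) < r"
    using near[OF ab'(3,4,1,2)] by (intro d) (simp add: d_def add_ac)
  ultimately show False
    by (simp add: dist_real_def r_def abs_if split: if_splits)
qed

lemma symmetric_second_derivative:
  fixes f :: "'a::real_normed_vector \<Rightarrow> 'b::euclidean_space"
  assumes "open S" "smooth_on f S" "x \<in> S"
  shows "FD (\<lambda>z. FD f z u) x v = FD (\<lambda>z. FD f z v) x u"
proof (rule euclidean_eqI)
  fix b :: 'b
  let ?g = "\<lambda>z. f z \<bullet> b"
  have g: "Ck_on 2 ?g S"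
    using smooth_on_bounded_linear[OF assms(1) bounded_linear_inner_left assms(2)] by (auto simp: smooth_on_def)
  have 1: "FD ?g z w = FD f z w \<bullet> b" if "z \<in> S" for z w
    using FD_eq[OF bounded_linear.has_derivative[OF bounded_linear_inner_left
        FD_works[OF smooth_on_imp_differentiable[OF assms(2) that]]]] by simp
  have 2: "FD (\<lambda>z. FD ?g z w) x w' = FD (\<lambda>z. FD f z w) x w' \<bullet> b" for w w'
  proof -
    have "FD (\<lambda>z. FD ?g z w) x = FD (\<lambda>z. FD f z w \<bullet> b) x"
      by (rule FD_cong[OF assms(1,3)]) (rule 1)
    also have "\<dots> = (\<lambda>w'. FD (\<lambda>z. FD f z w) x w' \<bullet> b)"
      by (intro FD_eq bounded_linear.has_derivative[OF bounded_linear_inner_left] FD_works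
         smooth_on_imp_differentiable[OF smooth_on_FD[OF assms(2)]] assms)
    finally show ?thesis by simp
  qed
  show "FD (\<lambda>z. FD f z u) x v \<bullet> b = FD (\<lambda>z. FD f z v) x u \<bullet> b"
    using symmetric_second_derivative_real[OF assms(1) g assms(3), of u v] by (simp add: 2)
qed

section \<open>Linear systems depending on a parameter\<close>

text \<open>Where \<open>h\<close> vanishes, the product rule needs only the continuity of the other factor, because its increment
  is multiplied by a quantity of first order. This breaks the circle in the differentiation of
  a solution of a linear system, where the unknown is a factor.\<close>

lemma has_derivative_continuous_scaleR_vanishing:
  fixes c :: "'a::real_normed_vector \<Rightarrow> real" and h :: "'a \<Rightarrow> 'b::real_normed_vector"
  assumes "isCont c x" "(h has_derivative h') (at x)" "h x = 0"
  shows "((\<lambda>z. c z *\<^sub>R h z) has_derivative (\<lambda>v. c x *\<^sub>R h' v)) (at x)"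
  unfolding has_derivative_at_within
proof (intro conjI)
  have bl: "bounded_linear h'"
    using assms(2) has_derivative_bounded_linear by blast
  show "bounded_linear (\<lambda>v. c x *\<^sub>R h' v)"
    by (rule bounded_linear_const_scaleR[OF bl])
  have r: "((\<lambda>z. (h z - h' (z - x)) /\<^sub>R norm (z - x)) \<longlongrightarrow> 0) (at x)"
    using assms(2,3) by (simp add: has_derivative_at_within)
  have c0: "((\<lambda>z. c z - c x) \<longlongrightarrow> 0) (at x)"
    using assms(1) by (simp add: isCont_def LIM_zero_iff)
  have c: "(c \<longlongrightarrow> c x) (at x)"
    using assms(1) by (simp add: isCont_def)
  obtain K where K: "\<And>v. norm (h' v) \<le> norm v * K"
    using bounded_linear.bounded[OF bl] by blast
  have "((\<lambda>z. (c z - c x) *\<^sub>R (h' (z - x) /\<^sub>R norm (z - x))) \<longlongrightarrow> 0) (at x)"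
  proof (rule Lim_null_comparison)
    show "((\<lambda>z. \<bar>c z - c x\<bar> * \<bar>K\<bar>) \<longlongrightarrow> 0) (at x)"
      using tendsto_mult_left_zero[OF tendsto_rabs_zero[OF c0]] .
    have "norm ((c z - c x) *\<^sub>R (h' (z - x) /\<^sub>R norm (z - x))) \<le> \<bar>c z - c x\<bar> * \<bar>K\<bar>" for z
    proof -
      have "norm (h' (z - x)) \<le> norm (z - x) * \<bar>K\<bar>"
        using K[of "z - x"] by (meson abs_ge_self mult_left_mono norm_ge_zero order_trans)
      then have "norm (h' (z - x) /\<^sub>R norm (z - x)) \<le> \<bar>K\<bar>"
        by (cases "z = x") (auto simp: field_simps)
      then show ?thesis
        unfolding norm_scaleR[of "c z - c x"] by (intro mult_left_mono) auto
    qed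
    then show "\<forall>\<^sub>F z in at x. norm ((c z - c x) *\<^sub>R (h' (z - x) /\<^sub>R norm (z - x))) \<le> \<bar>c z - c x\<bar> * \<bar>K\<bar>"
      by simp
  qed
  from tendsto_add[OF tendsto_scaleR[OF c r] this]
  have "((\<lambda>z. c z *\<^sub>R ((h z - h' (z - x)) /\<^sub>R norm (z - x))
      + (c z - c x) *\<^sub>R (h' (z - x) /\<^sub>R norm (z - x))) \<longlongrightarrow> 0) (at x)"
    by simp
  moreover have "c z *\<^sub>R ((h z - h' (z - x)) /\<^sub>R norm (z - x)) + (c z - c x) *\<^sub>R (h' (z - x) /\<^sub>R norm (z - x))
      = (c z *\<^sub>R h z - c x *\<^sub>R h x - c x *\<^sub>R h' (z - x)) /\<^sub>R norm (z - x)" for z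
    by (simp add: assms(3) algebra_simps)
  ultimately show "((\<lambda>z. (c z *\<^sub>R h z - c x *\<^sub>R h x - c x *\<^sub>R h' (z - x)) /\<^sub>R norm (z - x)) \<longlongrightarrow> 0) (at x)"
    by simp
qed

lemma linear_Basis_expansion:
  fixes f :: "'a::euclidean_space \<Rightarrow> 'b::real_vector"
  assumes "linear f"
  shows "f v = (\<Sum>b\<in>Basis. (v \<bullet> b) *\<^sub>R f b)"
proof -
  have "f (\<Sum>b\<in>Basis. (v \<bullet> b) *\<^sub>R b) = (\<Sum>b\<in>Basis. (v \<bullet> b) *\<^sub>R f b)"
    by (simp add: linear_sum[OF assms] linear_scale[OF assms])
  then show ?thesis
    by (simp add: euclidean_representation)
qed

text \<open>Since \<open>B x\<close> is bounded below by some \<open>m > 0\<close>, nearby maps \<open>B z\<close> are bounded below by \<open>m / 2\<close>, and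
  \<open>B z (s z - s x) = f z - B z (s x)\<close> tends to \<open>0\<close>.\<close>

lemma isCont_linear_system:
  fixes B :: "'a::real_normed_vector \<Rightarrow> 'b::euclidean_space \<Rightarrow> 'b"
  assumes "open S" "x \<in> S"
    and lin: "\<And>z. z \<in> S \<Longrightarrow> linear (B z)" and inj: "inj (B x)"
    and sol: "\<And>z. z \<in> S \<Longrightarrow> B z (s z) = f z"
    and contB: "\<And>b. isCont (\<lambda>z. B z b) x" and contf: "isCont f x"
  shows "isCont s x"
proof -
  obtain m where m: "m > 0" "\<And>v. m * norm v \<le> norm (B x v)"
    using linear_inj_bounded_below_pos[OF lin[OF assms(2)] inj] by blast
  define e where "e z = (\<Sum>b\<in>Basis. norm (B z b - B x b))" for z
  have diff_le: "norm (B z v - B x v) \<le> norm v * e z" if "z \<in> S" for z v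
  proof -
    have "B z v - B x v = (\<Sum>b\<in>Basis. (v \<bullet> b) *\<^sub>R (B z b - B x b))"
      using linear_Basis_expansion[OF lin[OF that], of v] linear_Basis_expansion[OF lin[OF assms(2)], of v]
      by (simp add: sum_subtractf scaleR_diff_right)
    also have "norm \<dots> \<le> (\<Sum>b\<in>Basis. norm v * norm (B z b - B x b))"
      by (intro sum_norm_le) (auto intro!: mult_right_mono Basis_le_norm)
    finally show ?thesis
      by (simp add: e_def sum_distrib_left)
  qed
  have "((\<lambda>z. norm (B z b - B x b)) \<longlongrightarrow> 0) (at x)" for b
    using contB[of b] by (simp add: isCont_def LIM_zero_iff tendsto_norm_zero)
  then have "((\<lambda>z. \<Sum>b\<in>Basis. norm (B z b - B x b)) \<longlongrightarrow> (\<Sum>b\<in>(Basis::'b set). 0)) (at x)"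
    by (intro tendsto_sum) auto
  then have "(e \<longlongrightarrow> 0) (at x)"
    by (simp add: e_def[abs_def])
  then have "\<forall>\<^sub>F z in at x. e z < m / 2"
    using m(1) by (intro order_tendstoD) auto
  moreover have "\<forall>\<^sub>F z in at x. z \<in> S"
    using assms(1,2) eventually_at_in_open' by blast
  ultimately have le: "\<forall>\<^sub>F z in at x. norm (s z - s x) \<le> norm (f z - B z (s x)) * (2 / m)"
  proof eventually_elim
    case (elim z)
    let ?d = "s z - s x"
    have Bzd: "B z ?d = f z - B z (s x)"
      by (simp add: linear_diff[OF lin[OF elim(2)]] sol[OF elim(2)])
    have "m * norm ?d \<le> norm (B x ?d)"
      by (rule m)
    also have "\<dots> \<le> norm (B z ?d) + norm (B z ?d - B x ?d)"
      by norm
    also have "\<dots> \<le> norm (B z ?d) + norm ?d * e z"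
      using diff_le[OF elim(2)] by simp
    also have "\<dots> \<le> norm (B z ?d) + norm ?d * (m / 2)"
      using elim(1) by (intro add_left_mono mult_left_mono) auto
    finally have "m * norm ?d / 2 \<le> norm (B z ?d)"
      by (simp add: field_simps)
    then show ?case
      using m(1) by (simp add: Bzd field_simps)
  qed
  have "isCont (\<lambda>z. \<Sum>b\<in>Basis. (s x \<bullet> b) *\<^sub>R B z b) x"
    by (intro continuous_sum continuous_scaleR continuous_const contB)
  then have "((\<lambda>z. \<Sum>b\<in>Basis. (s x \<bullet> b) *\<^sub>R B z b) \<longlongrightarrow> B x (s x)) (at x)"
    using linear_Basis_expansion[OF lin[OF assms(2)], of "s x"] by (simp add: isCont_def)
  moreover have "\<forall>\<^sub>F z in at x. (\<Sum>b\<in>Basis. (s x \<bullet> b) *\<^sub>R B z b) = B z (s x)"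
    using eventually_at_in_open'[OF assms(1,2)]
    by eventually_elim (rule linear_Basis_expansion[OF lin, symmetric])
  ultimately have "((\<lambda>z. B z (s x)) \<longlongrightarrow> B x (s x)) (at x)"
    using tendsto_cong by fast
  then have "((\<lambda>z. f z - B z (s x)) \<longlongrightarrow> f x - B x (s x)) (at x)"
    using contf by (intro tendsto_diff) (auto simp: isCont_def)
  then have "((\<lambda>z. norm (f z - B z (s x)) * (2 / m)) \<longlongrightarrow> 0) (at x)"
    using sol[OF assms(2)] by (intro tendsto_mult_left_zero tendsto_norm_zero) simp
  then have "((\<lambda>z. s z - s x) \<longlongrightarrow> 0) (at x)"
    by (rule Lim_null_comparison[OF le])
  then show ?thesis
    by (simp add: isCont_def LIM_zero_iff)
qed

text \<open>Implicit differentiation of \<open>B z (s z) = f z\<close>. The differentiability of \<open>s\<close> is part of the conclusion, so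
  the equation is first written with the constant matrix \<open>B x\<close> on the left.\<close>

lemma linear_system_has_derivative:
  fixes B :: "'a::real_normed_vector \<Rightarrow> 'b::euclidean_space \<Rightarrow> 'b"
  assumes "open S" "x \<in> S"
    and lin: "\<And>z. z \<in> S \<Longrightarrow> linear (B z)" and inj: "inj (B x)"
    and sol: "\<And>z. z \<in> S \<Longrightarrow> B z (s z) = f z"
    and diffB: "\<And>b. (\<lambda>z. B z b) differentiable at x" and difff: "f differentiable at x"
  shows "s differentiable at x"
    and "B x (FD s x v) = FD f x v - (\<Sum>b\<in>Basis. (s x \<bullet> b) *\<^sub>R FD (\<lambda>z. B z b) x v)"
proof -
  have conts: "isCont s x"
    using isCont_linear_system[where f = f and B = B and s = s, OF assms(1,2) lin inj sol]
      differentiable_imp_continuous_within[OF diffB] differentiable_imp_continuous_within[OF difff] by simp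
  obtain G where G: "linear G" "\<And>v. G (B x v) = v" "\<And>v. B x (G v) = v"
    using linear_injective_isomorphism[OF lin[OF assms(2)] inj] by blast
  \<comment> \<open>the right-hand side of \<open>B x (s z) = f z - (B z - B x) (s z)\<close>, in which \<open>s\<close> meets only factors
    that vanish at \<open>x\<close>\<close>
  define r where "r z = f z - (\<Sum>b\<in>Basis. (s z \<bullet> b) *\<^sub>R (B z b - B x b))" for z
  define r' where "r' v = FD f x v - (\<Sum>b\<in>Basis. (s x \<bullet> b) *\<^sub>R FD (\<lambda>z. B z b) x v)" for v
  have "((\<lambda>z. B z b - B x b) has_derivative FD (\<lambda>z. B z b) x) (at x)" for b
    using has_derivative_diff[OF FD_works[OF diffB[of b]] has_derivative_const[of "B x b"]] by simp
  then have "(r has_derivative r') (at x)"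
    unfolding r_def[abs_def] r'_def[abs_def] using conts
    by (intro has_derivative_diff has_derivative_sum has_derivative_continuous_scaleR_vanishing
         FD_works difff continuous_inner continuous_const) auto
  then have "((\<lambda>z. G (r z)) has_derivative (\<lambda>v. G (r' v))) (at x)"
    by (rule bounded_linear.has_derivative[OF linear_conv_bounded_linear[THEN iffD1, OF G(1)]])
  moreover have "G (r z) = s z" if "z \<in> S" for z
  proof -
    have "(\<Sum>b\<in>Basis. (s z \<bullet> b) *\<^sub>R (B z b - B x b)) = B z (s z) - B x (s z)"
      using linear_Basis_expansion[OF lin[OF that], of "s z"] linear_Basis_expansion[OF lin[OF assms(2)], of "s z"]
      by (simp add: sum_subtractf scaleR_diff_right)
    then show ?thesis
      using sol[OF that] by (simp add: r_def G)
  qed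
  ultimately have "(s has_derivative (\<lambda>v. G (r' v))) (at x)"
    using has_derivative_transform_within_open assms(1,2) by blast
  then show "s differentiable at x" and "B x (FD s x v) = FD f x v - (\<Sum>b\<in>Basis. (s x \<bullet> b) *\<^sub>R FD (\<lambda>z. B z b) x v)"
    by (auto simp: differentiable_def FD_eq G r'_def)
qed

text \<open>The derivative of the solution solves a system with the same matrix whose right-hand side involves only the
  solution itself and derivatives of the data. Hence one induction over \<open>k\<close>, for all right-hand sides at once,
  gives the regularity without determinants or inverse matrices.\<close>

lemma Ck_on_linear_system:
  fixes B :: "'a::real_normed_vector \<Rightarrow> 'b::euclidean_space \<Rightarrow> 'b"
  assumes "open S"
    and lin: "\<And>z. z \<in> S \<Longrightarrow> linear (B z)" and inj: "\<And>z. z \<in> S \<Longrightarrow> inj (B z)"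
    and sol: "\<And>z. z \<in> S \<Longrightarrow> B z (s z) = f z"
    and "\<And>b. Ck_on k (\<lambda>z. B z b) S" "Ck_on k f S"
  shows "Ck_on k s S"
  using assms(4-6)
proof (induction k arbitrary: f s)
  case 0
  then have "isCont s x" if "x \<in> S" for x
    using isCont_linear_system[where f = f and B = B and s = s, OF assms(1) that lin inj[OF that]] that assms(1)
    by (simp add: continuous_on_eq_continuous_at)
  then show ?case
    using assms(1) by (auto simp: continuous_on_eq_continuous_at)
next
  case (Suc k)
  have d: "(\<lambda>z. B z b) differentiable at x" "f differentiable at x" if "x \<in> S" for x b
    using Suc.prems that by auto
  note der = linear_system_has_derivative[OF assms(1) _ lin inj Suc.prems(1) d]
  have s: "Ck_on k s S"
    by (rule Suc.IH[OF Suc.prems(1) Ck_on_SucD[OF Suc.prems(2)] Ck_on_SucD[OF Suc.prems(3)]])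
  show ?case
    unfolding Ck_on.simps(2)
  proof (intro conjI ballI allI)
    show "s differentiable at x" if "x \<in> S" for x
      using der(1) that by simp
    show "Ck_on k (\<lambda>x. FD s x v) S" for v
    proof (rule Suc.IH)
      show "B x (FD s x v) = FD f x v + (-1) *\<^sub>R (\<Sum>b\<in>Basis. (s x \<bullet> b) *\<^sub>R FD (\<lambda>z. B z b) x v)"
        if "x \<in> S" for x
        using der(2) that by simp
      show "Ck_on k (\<lambda>z. B z b) S" for b
        by (rule Ck_on_SucD[OF Suc.prems(2)])
      show "Ck_on k (\<lambda>x. FD f x v + (-1) *\<^sub>R (\<Sum>b\<in>Basis. (s x \<bullet> b) *\<^sub>R FD (\<lambda>z. B z b) x v)) S"
        using Suc.prems(2,3) s
        by (intro Ck_on_add Ck_on_bounded_linear[OF _ bounded_linear_scaleR_right] Ck_on_sum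
             Ck_on_bilinear[OF _ bounded_bilinear_scaleR]
             Ck_on_bounded_linear[OF _ bounded_linear_inner_left] assms(1)) auto
    qed
  qed
qed

section \<open>Manifolds in charts\<close>

abbreviation transition :: "('a, 'e) chart \<Rightarrow> ('a, 'e) chart \<Rightarrow> 'e \<Rightarrow> 'e" where
  "transition c d \<equiv> snd d \<circ> chart_inv c"

abbreviation coord_field :: "('a, 'e::euclidean_space) vfield \<Rightarrow> ('a, 'e) chart \<Rightarrow> 'e \<Rightarrow> 'e" where
  "coord_field X c \<equiv> (\<lambda>x. X (chart_inv c x) c)"

text \<open>The tangent vector at \<open>p\<close> whose component in the chart \<open>c\<close> is \<open>u\<close>.\<close>

definition tangent_vector ::
    "('a, 'e::euclidean_space) chart set \<Rightarrow> ('a, 'e) chart \<Rightarrow> 'a \<Rightarrow> 'e \<Rightarrow> ('a, 'e) tvec" where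
  "tangent_vector A c p u = (\<lambda>d. if d \<in> charts_at A p then FD (transition c d) (snd c p) u else 0)"

text \<open>The regularity that a Lie bracket at \<open>p\<close> requires. It is weaker than smoothness near \<open>p\<close> because the
  canonical spray is in general only \<open>C\<^sup>1\<close> along the zero section.\<close>

definition differentiable_vfield_at ::
    "('a, 'e::euclidean_space) chart set \<Rightarrow> 'a \<Rightarrow> ('a, 'e) vfield \<Rightarrow> bool" where
  "differentiable_vfield_at A p X \<longleftrightarrow>
     (\<exists>W. manifold_open A W \<and> p \<in> W \<and> (\<forall>q\<in>W. X q \<in> tangent_space A q)) \<and>
     (\<forall>c\<in>charts_at A p. coord_field X c differentiable at (snd c p))"

lemma charts_atI [intro]: "c \<in> A \<Longrightarrow> p \<in> fst c \<Longrightarrow> c \<in> charts_at A p"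
  by (simp add: charts_at_def)

locale atlas =
  fixes A :: "('a, 'e::euclidean_space) chart set"
  assumes smooth_atlas: "smooth_atlas A"
begin

lemma inj_on_chart: "c \<in> A \<Longrightarrow> inj_on (snd c) (fst c)"
  using smooth_atlas by (simp add: smooth_atlas_def)

lemma chart_inv_chart: "c \<in> A \<Longrightarrow> p \<in> fst c \<Longrightarrow> chart_inv c (snd c p) = p"
  using inj_on_chart by (simp add: inv_into_f_f)

lemma chart_inv_in: "x \<in> snd c ` fst c \<Longrightarrow> chart_inv c x \<in> fst c"
  by (rule inv_into_into)

lemma open_overlap: "c \<in> A \<Longrightarrow> d \<in> A \<Longrightarrow> open (snd c ` (fst c \<inter> fst d))"
  using smooth_atlas by (simp add: smooth_atlas_def)

lemma open_chart_image: "c \<in> A \<Longrightarrow> open (snd c ` fst c)"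
  using open_overlap[of c c] by simp

lemma open_chart_image_Int: "manifold_open A W \<Longrightarrow> c \<in> A \<Longrightarrow> open (snd c ` (fst c \<inter> W))"
  by (simp add: manifold_open_def)

lemma manifold_open_Int: "manifold_open A V \<Longrightarrow> manifold_open A W \<Longrightarrow> manifold_open A (V \<inter> W)"
  using openin_atlas_topology[OF smooth_atlas] by (metis openin_Int)

lemma manifold_open_chart: "c \<in> A \<Longrightarrow> manifold_open A (fst c)"
  using open_overlap by (auto simp: manifold_open_def carrier_of_def)

lemma smooth_transition:
  "c \<in> A \<Longrightarrow> d \<in> A \<Longrightarrow> smooth_on (transition c d) (snd c ` (fst c \<inter> fst d))"
  using smooth_atlas by (simp add: smooth_atlas_def)

lemma transition_chart: "c \<in> A \<Longrightarrow> p \<in> fst c \<Longrightarrow> transition c d (snd c p) = snd d p"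
  by (simp add: chart_inv_chart)

lemma differentiable_transition:
  "c \<in> A \<Longrightarrow> d \<in> A \<Longrightarrow> p \<in> fst c \<Longrightarrow> p \<in> fst d \<Longrightarrow> transition c d differentiable at (snd c p)"
  by (rule smooth_on_imp_differentiable[OF smooth_transition]) auto

lemma FD_through_transition:
  assumes "c \<in> A" "d \<in> A" "p \<in> fst c" "p \<in> fst d" "f \<circ> chart_inv d differentiable at (snd d p)"
  shows "((f \<circ> chart_inv c) has_derivative
    (\<lambda>u. FD (f \<circ> chart_inv d) (snd d p) (FD (transition c d) (snd c p) u))) (at (snd c p))"
proof -
  have "((\<lambda>x. (f \<circ> chart_inv d) (transition c d x)) has_derivative
      (\<lambda>u. FD (f \<circ> chart_inv d) (snd d p) (FD (transition c d) (snd c p) u))) (at (snd c p))"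
  proof (rule has_derivative_compose[where f = "transition c d" and f' = "FD (transition c d) (snd c p)"])
    show "(transition c d has_derivative FD (transition c d) (snd c p)) (at (snd c p))"
      by (rule FD_works[OF differentiable_transition[OF assms(1-4)]])
    show "((f \<circ> chart_inv d) has_derivative FD (f \<circ> chart_inv d) (snd d p)) (at (transition c d (snd c p)))"
      using FD_works[OF assms(5)] transition_chart[OF assms(1,3)] by simp
  qed
  then show ?thesis
  proof (rule has_derivative_transform_within_open)
    show "open (snd c ` (fst c \<inter> fst d))"
      using open_overlap assms by blast
    show "snd c p \<in> snd c ` (fst c \<inter> fst d)"
      using assms by blast
    show "(f \<circ> chart_inv d) (transition c d x) = (f \<circ> chart_inv c) x"
      if "x \<in> snd c ` (fst c \<inter> fst d)" for x
      using that assms by (auto simp: chart_inv_chart)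
  qed
qed

text \<open>The cocycle identity, i.e. the chain rule for coordinate changes. It makes \<open>tangent_vector\<close> a tangent vector.\<close>

lemma FD_transition_comp:
  assumes "c \<in> A" "d \<in> A" "e \<in> A" "p \<in> fst c" "p \<in> fst d" "p \<in> fst e"
  shows "FD (transition d e) (snd d p) (FD (transition c d) (snd c p) u) = FD (transition c e) (snd c p) u"
proof -
  have "((\<lambda>x. transition d e (transition c d x)) has_derivative
      (\<lambda>u. FD (transition d e) (snd d p) (FD (transition c d) (snd c p) u))) (at (snd c p))"
  proof (rule has_derivative_compose[where f = "transition c d" and f' = "FD (transition c d) (snd c p)"])
    show "(transition c d has_derivative FD (transition c d) (snd c p)) (at (snd c p))"
      by (rule FD_works[OF differentiable_transition]) fact+
    show "(transition d e has_derivative FD (transition d e) (snd d p)) (at (transition c d (snd c p)))"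
      using FD_works[OF differentiable_transition[of d e p]] transition_chart[of c p d] assms by simp
  qed
  then have "(transition c e has_derivative
      (\<lambda>u. FD (transition d e) (snd d p) (FD (transition c d) (snd c p) u))) (at (snd c p))"
  proof (rule has_derivative_transform_within_open)
    show "open (snd c ` (fst c \<inter> fst d))"
      using open_overlap assms by blast
    show "snd c p \<in> snd c ` (fst c \<inter> fst d)"
      using assms by blast
    show "transition d e (transition c d x) = transition c e x"
      if "x \<in> snd c ` (fst c \<inter> fst d)" for x
      using that assms by (auto simp: chart_inv_chart)
  qed
  then show ?thesis
    by (simp add: FD_eq)
qed

lemma FD_transition_self:
  assumes "c \<in> A" "p \<in> fst c"
  shows "FD (transition c c) (snd c p) u = u"
proof -
  have "FD (transition c c) (snd c p) = FD (\<lambda>x. x) (snd c p)"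
    by (rule FD_cong[OF open_chart_image[OF assms(1)]]) (use assms in \<open>auto simp: chart_inv_chart\<close>)
  then show ?thesis by simp
qed

lemma tangent_space_transition:
  "v \<in> tangent_space A p \<Longrightarrow> c \<in> charts_at A p \<Longrightarrow> d \<in> charts_at A p \<Longrightarrow>
   v d = FD (transition c d) (snd c p) (v c)"
  unfolding tangent_space_def by blast

lemma tangent_space_outside: "v \<in> tangent_space A p \<Longrightarrow> c \<notin> charts_at A p \<Longrightarrow> v c = 0"
  unfolding tangent_space_def by blast

lemma tangent_spaceI:
  assumes "\<And>c. c \<notin> charts_at A p \<Longrightarrow> v c = 0"
    and "\<And>c d. c \<in> charts_at A p \<Longrightarrow> d \<in> charts_at A p \<Longrightarrow> v d = FD (transition c d) (snd c p) (v c)"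
  shows "v \<in> tangent_space A p"
  unfolding tangent_space_def using assms by blast

lemma tangent_space_eqI:
  assumes "v \<in> tangent_space A p" "w \<in> tangent_space A p" "c \<in> charts_at A p" "v c = w c"
  shows "v = w"
proof
  fix d
  show "v d = w d"
  proof (cases "d \<in> charts_at A p")
    case True
    then show ?thesis
      using tangent_space_transition assms by metis
  next
    case False
    then show ?thesis
      using tangent_space_outside assms(1,2) by metis
  qed
qed

lemma tangent_vector_in_tangent_space:
  assumes "c \<in> A" "p \<in> fst c"
  shows "tangent_vector A c p u \<in> tangent_space A p"
proof (rule tangent_spaceI)
  fix d e assume "d \<in> charts_at A p" "e \<in> charts_at A p"
  then show "tangent_vector A c p u e = FD (transition d e) (snd d p) (tangent_vector A c p u d)"
    using FD_transition_comp[of c d e p u] assms by (simp add: tangent_vector_def charts_at_def)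
qed (simp add: tangent_vector_def)

lemma tangent_vector_chart: "c \<in> A \<Longrightarrow> p \<in> fst c \<Longrightarrow> tangent_vector A c p u c = u"
  by (simp add: tangent_vector_def charts_at_def FD_transition_self)

lemma tangent_vector_eq:
  assumes "v \<in> tangent_space A p" "c \<in> charts_at A p"
  shows "tangent_vector A c p (v c) = v"
  using assms tangent_vector_in_tangent_space tangent_vector_chart
  by (intro tangent_space_eqI[OF _ assms]) (auto simp: charts_at_def)

lemma tangent_space_combination:
  assumes "v \<in> tangent_space A p" "w \<in> tangent_space A p"
  shows "(\<lambda>c. a *\<^sub>R v c + b *\<^sub>R w c) \<in> tangent_space A p"
proof -
  have "a *\<^sub>R v d + b *\<^sub>R w d = FD (transition c d) (snd c p) (a *\<^sub>R v c + b *\<^sub>R w c)"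
    if "c \<in> charts_at A p" "d \<in> charts_at A p" for c d
  proof -
    have "linear (FD (transition c d) (snd c p))"
      using that by (intro bounded_linear.linear bounded_linear_FD differentiable_transition) (auto simp: charts_at_def)
    then show ?thesis
      using tangent_space_transition[OF assms(1) that] tangent_space_transition[OF assms(2) that]
      by (simp add: linear_add linear_scale)
  qed
  moreover have "a *\<^sub>R v c + b *\<^sub>R w c = 0" if "c \<notin> charts_at A p" for c
    using assms that by (simp add: tangent_space_outside)
  ultimately show ?thesis
    by (rule tangent_spaceI[rotated])
qed

lemma tangent_space_add:
  "v \<in> tangent_space A p \<Longrightarrow> w \<in> tangent_space A p \<Longrightarrow> (\<lambda>c. v c + w c) \<in> tangent_space A p"
  using tangent_space_combination[of v p w 1 1] by simp

lemma tangent_space_diff: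
  "v \<in> tangent_space A p \<Longrightarrow> w \<in> tangent_space A p \<Longrightarrow> (\<lambda>c. v c - w c) \<in> tangent_space A p"
  using tangent_space_combination[of v p w 1 "-1"] by simp

lemma tangent_space_scaleR:
  "v \<in> tangent_space A p \<Longrightarrow> (\<lambda>c. a *\<^sub>R v c) \<in> tangent_space A p"
  using tangent_space_combination[of v p v a 0] by simp

lemma tangent_space_minus:
  "v \<in> tangent_space A p \<Longrightarrow> (\<lambda>c. - v c) \<in> tangent_space A p"
  using tangent_space_scaleR[of v p "-1"] by simp

lemma tzero_in_tangent_space: "tzero \<in> tangent_space A p"
proof -
  have "FD (transition c d) (snd c p) 0 = 0" if "c \<in> charts_at A p" "d \<in> charts_at A p" for c d
    using that by (intro linear_0 bounded_linear.linear bounded_linear_FD differentiable_transition)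
      (auto simp: charts_at_def)
  then show ?thesis
    by (intro tangent_spaceI) simp_all
qed

text \<open>Chart independence of the differential. Differentiability in one chart is enough, as it is carried to
  the others by the smooth coordinate changes.\<close>

lemma differential_eq:
  assumes "c \<in> charts_at A p" "v \<in> tangent_space A p" "f \<circ> chart_inv c differentiable at (snd c p)"
  shows "differential A f p v = FD (f \<circ> chart_inv c) (snd c p) (v c)"
proof -
  have "FD (f \<circ> chart_inv d) (snd d p) (v d) = FD (f \<circ> chart_inv c) (snd c p) (v c)"
    if d: "d \<in> charts_at A p" for d
  proof -
    have "FD (f \<circ> chart_inv d) (snd d p) (v d)
        = FD (f \<circ> chart_inv c) (snd c p) (FD (transition d c) (snd d p) (v d))"
      using FD_eq[OF FD_through_transition[of d c p f]] assms d by (auto simp: charts_at_def)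
    then show ?thesis
      using tangent_space_transition[OF assms(2) d assms(1)] by simp
  qed
  then show ?thesis
    unfolding differential_def using assms(1) by (intro the_equality) metis+
qed

lemma coord_field_transition:
  assumes "X q \<in> tangent_space A q" "c \<in> charts_at A q" "d \<in> charts_at A q"
  shows "coord_field X d (transition c d (snd c q)) = FD (transition c d) (snd c q) (coord_field X c (snd c q))"
  using tangent_space_transition[OF assms] assms(2,3) by (simp add: chart_inv_chart charts_at_def)

text \<open>The components of a field in two charts satisfy \<open>X\<^sub>d (\<tau> y) = D\<tau>(y) (X\<^sub>c y)\<close>, where \<open>\<tau>\<close> is the coordinate
  change; this is the derivative of that identity. The second-order term is what has to cancel in a Lie bracket.\<close>

lemma FD_coord_field_transition:
  assumes "differentiable_vfield_at A p X" "c \<in> charts_at A p" "d \<in> charts_at A p"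
  shows "FD (coord_field X d) (snd d p) (FD (transition c d) (snd c p) u)
      = FD (transition c d) (snd c p) (FD (coord_field X c) (snd c p) u)
        + FD (\<lambda>y. FD (transition c d) y (X p c)) (snd c p) u"
proof -
  let ?t = "transition c d" and ?x = "snd c p"
  have cd: "c \<in> A" "p \<in> fst c" "d \<in> A" "p \<in> fst d"
    using assms by (auto simp: charts_at_def)
  obtain W where W: "manifold_open A W" "p \<in> W" "\<And>q. q \<in> W \<Longrightarrow> X q \<in> tangent_space A q"
    and dX: "\<And>c. c \<in> charts_at A p \<Longrightarrow> coord_field X c differentiable at (snd c p)"
    using assms(1) unfolding differentiable_vfield_at_def by blast
  have "manifold_open A (fst d \<inter> W)"
    using manifold_open_Int manifold_open_chart W cd by blast
  then have o: "open (snd c ` (fst c \<inter> (fst d \<inter> W)))"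
    using open_chart_image_Int cd by blast
  have p: "?x \<in> snd c ` (fst c \<inter> (fst d \<inter> W))"
    using cd W by blast
  have "((\<lambda>y. FD ?t y (coord_field X c y)) has_derivative
     (\<lambda>u. FD ?t ?x (FD (coord_field X c) ?x u) + FD (\<lambda>y. FD ?t y (coord_field X c ?x)) ?x u)) (at ?x)"
    using cd assms by (intro has_derivative_FD_apply[OF open_overlap _ smooth_transition] dX) auto
  then have 1: "((\<lambda>y. coord_field X d (?t y)) has_derivative
     (\<lambda>u. FD ?t ?x (FD (coord_field X c) ?x u) + FD (\<lambda>y. FD ?t y (coord_field X c ?x)) ?x u)) (at ?x)"
  proof (rule has_derivative_transform_within_open[OF _ o p])
    fix y assume "y \<in> snd c ` (fst c \<inter> (fst d \<inter> W))"
    then obtain q where q: "y = snd c q" "q \<in> fst c" "q \<in> fst d" "q \<in> W" by auto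
    then show "FD ?t y (coord_field X c y) = coord_field X d (?t y)"
      using coord_field_transition[of X q c d, OF W(3)] cd by (simp only: charts_atI)
  qed
  have 2: "((\<lambda>y. coord_field X d (?t y)) has_derivative
     (\<lambda>u. FD (coord_field X d) (snd d p) (FD ?t ?x u))) (at ?x)"
  proof (rule has_derivative_compose[where f = ?t and f' = "FD ?t ?x"])
    show "(?t has_derivative FD ?t ?x) (at ?x)"
      by (rule FD_works[OF differentiable_transition]) fact+
    show "(coord_field X d has_derivative FD (coord_field X d) (snd d p)) (at (?t ?x))"
      using FD_works[OF dX[OF assms(3)]] transition_chart[of c p d] cd by simp
  qed
  show ?thesis
    using fun_cong[OF has_derivative_unique[OF 2 1], of u] cd by (simp add: chart_inv_chart)
qed

text \<open>The terms with second derivatives of the coordinate change cancel because these are symmetric. Only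
  differentiability at \<open>p\<close> is assumed: the canonical spray is not \<open>C\<^sup>2\<close> along the zero section.\<close>

lemma lie_bracket_in_tangent_space:
  assumes X: "differentiable_vfield_at A p X" and Y: "differentiable_vfield_at A p Y"
  shows "lie_bracket A X Y p \<in> tangent_space A p"
proof -
  have "lie_bracket A X Y p d = FD (transition c d) (snd c p) (lie_bracket A X Y p c)"
    if c: "c \<in> charts_at A p" and d: "d \<in> charts_at A p" for c d
  proof -
    have cd: "c \<in> A" "p \<in> fst c" "d \<in> A" "p \<in> fst d"
      using c d by (auto simp: charts_at_def)
    let ?t = "transition c d" and ?x = "snd c p"
    have XY: "X p \<in> tangent_space A p" "Y p \<in> tangent_space A p"
      using X Y by (auto simp: differentiable_vfield_at_def)
    \<comment> \<open>the second derivatives of the coordinate change cancel by this symmetry\<close>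
    have sym: "FD (\<lambda>y. FD ?t y v) ?x w = FD (\<lambda>y. FD ?t y w) ?x v" for v w
      using cd by (intro symmetric_second_derivative[OF open_overlap smooth_transition]) auto
    have lin: "linear (FD ?t ?x)"
      using cd by (intro bounded_linear.linear bounded_linear_FD differentiable_transition)
    have "lie_bracket A X Y p d
        = FD (coord_field Y d) (snd d p) (FD ?t ?x (X p c)) - FD (coord_field X d) (snd d p) (FD ?t ?x (Y p c))"
      using c d tangent_space_transition[OF XY(1) c d] tangent_space_transition[OF XY(2) c d]
      by (simp add: lie_bracket_def)
    also have "\<dots> = FD ?t ?x (FD (coord_field Y c) ?x (X p c)) - FD ?t ?x (FD (coord_field X c) ?x (Y p c))"
      using FD_coord_field_transition[OF X c d] FD_coord_field_transition[OF Y c d]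
        sym[of "X p c" "Y p c"] by simp
    also have "\<dots> = FD ?t ?x (lie_bracket A X Y p c)"
      using c by (simp add: lie_bracket_def linear_diff[OF lin])
    finally show ?thesis .
  qed
  moreover have "lie_bracket A X Y p c = 0" if "c \<notin> charts_at A p" for c
    using that by (simp add: lie_bracket_def)
  ultimately show ?thesis
    by (rule tangent_spaceI[rotated])
qed

lemma smooth_vfield_near_differentiable:
  assumes "smooth_vfield_near A p X"
  shows "differentiable_vfield_at A p X"
proof -
  obtain W where W: "manifold_open A W" "p \<in> W" "smooth_vfield A W X"
    using assms by (auto simp: smooth_vfield_near_def)
  have "coord_field X c differentiable at (snd c p)" if "c \<in> charts_at A p" for c
    using W that smooth_on_imp_differentiable[of "coord_field X c" "snd c ` (fst c \<inter> W)"]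
    by (auto simp: smooth_vfield_def charts_at_def)
  then show ?thesis
    using W by (auto simp: differentiable_vfield_at_def smooth_vfield_def)
qed

text \<open>The extension has constant components in one chart. Tensors that are defined by the values on extensions
  are thereby determined uniquely.\<close>

lemma ex_smooth_vfield_extension:
  assumes "c \<in> charts_at A p" "v \<in> tangent_space A p"
  shows "\<exists>X. smooth_vfield_near A p X \<and> X p = v"
proof -
  have c: "c \<in> A" "p \<in> fst c"
    using assms by (auto simp: charts_at_def)
  define X where "X q = tangent_vector A c q (v c)" for q
  have "smooth_on (coord_field X d) (snd d ` (fst d \<inter> fst c))" if d: "d \<in> A" for d
  proof (rule smooth_on_cong[OF open_overlap[OF d c(1)]])
    show "smooth_on (\<lambda>x. FD (transition c d) (transition d c x) (v c)) (snd d ` (fst d \<inter> fst c))"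
    proof (rule smooth_on_compose[OF open_overlap[OF d c(1)] smooth_on_FD[OF smooth_transition[OF c(1) d]]
          smooth_transition[OF d c(1)]])
      show "transition d c ` snd d ` (fst d \<inter> fst c) \<subseteq> snd c ` (fst c \<inter> fst d)"
        using d by (auto simp: chart_inv_chart)
    qed
    show "FD (transition c d) (transition d c x) (v c) = coord_field X d x"
      if "x \<in> snd d ` (fst d \<inter> fst c)" for x
      using that d by (auto simp: X_def tangent_vector_def chart_inv_chart charts_at_def)
  qed
  then have "smooth_vfield A (fst c) X"
    using tangent_vector_in_tangent_space[OF c(1)] by (simp add: smooth_vfield_def X_def)
  moreover have "X p = v"
    using tangent_vector_eq[OF assms(2,1)] by (simp add: X_def)
  ultimately show ?thesis
    using manifold_open_chart[OF c(1)] c(2) by (auto simp: smooth_vfield_near_def)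
qed

end

section \<open>The atlas of the tangent bundle\<close>

context atlas
begin

lemma tangent_chart_domain: "(p, v) \<in> fst (tangent_chart A c) \<longleftrightarrow> p \<in> fst c \<and> v \<in> tangent_space A p"
  by (simp add: tangent_chart_def)

lemma tangent_chart_apply: "snd (tangent_chart A c) (p, v) = (snd c p, v c)"
  by (simp add: tangent_chart_def)

lemma inj_on_tangent_chart: "c \<in> A \<Longrightarrow> inj_on (snd (tangent_chart A c)) (fst (tangent_chart A c))"
proof (rule inj_onI)
  fix q r assume c: "c \<in> A" and q: "q \<in> fst (tangent_chart A c)" and r: "r \<in> fst (tangent_chart A c)"
    and eq: "snd (tangent_chart A c) q = snd (tangent_chart A c) r"
  obtain p v p' v' where qr: "q = (p, v)" "r = (p', v')"
    by (cases q, cases r) auto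
  have "p = p'"
    using q r eq inj_onD[OF inj_on_chart[OF c]] by (auto simp: qr tangent_chart_domain tangent_chart_apply)
  moreover have "v = v'"
    using q r eq c \<open>p = p'\<close> by (intro tangent_space_eqI[of v p v' c]) (auto simp: qr tangent_chart_domain tangent_chart_apply)
  ultimately show "q = r"
    by (simp add: qr)
qed

lemma chart_inv_tangent_chart:
  assumes "c \<in> A" "p \<in> fst c"
  shows "chart_inv (tangent_chart A c) (snd c p, u) = (p, tangent_vector A c p u)"
proof -
  have "(snd c p, u) = snd (tangent_chart A c) (p, tangent_vector A c p u)"
    using assms by (simp add: tangent_chart_apply tangent_vector_chart)
  then show ?thesis
    using inv_into_f_f[OF inj_on_tangent_chart[OF assms(1)]] assms
    by (simp add: tangent_chart_domain tangent_vector_in_tangent_space)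
qed

lemma tangent_chart_overlap_image:
  assumes "c \<in> A"
  shows "snd (tangent_chart A c) ` (fst (tangent_chart A c) \<inter> fst (tangent_chart A d))
    = snd c ` (fst c \<inter> fst d) \<times> UNIV"
proof (intro equalityI subsetI)
  fix z assume "z \<in> snd c ` (fst c \<inter> fst d) \<times> (UNIV :: 'e set)"
  then obtain p u where p: "p \<in> fst c" "p \<in> fst d" "z = (snd c p, u)" by auto
  have "(p, tangent_vector A c p u) \<in> fst (tangent_chart A c) \<inter> fst (tangent_chart A d)"
    using p assms by (simp add: tangent_chart_domain tangent_vector_in_tangent_space)
  moreover have "z = snd (tangent_chart A c) (p, tangent_vector A c p u)"
    using p assms by (simp add: tangent_chart_apply tangent_vector_chart)
  ultimately show "z \<in> snd (tangent_chart A c) ` (fst (tangent_chart A c) \<inter> fst (tangent_chart A d))"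
    by blast
qed (auto simp: tangent_chart_domain tangent_chart_apply)

lemma tangent_chart_image:
  assumes "c \<in> A"
  shows "snd (tangent_chart A c) ` fst (tangent_chart A c) = snd c ` fst c \<times> UNIV"
  using tangent_chart_overlap_image[OF assms, of c] by simp

text \<open>The change of induced coordinates is \<open>(x, y) \<mapsto> (\<tau> x, D\<tau>(x) y)\<close>, where \<open>\<tau>\<close> is the change of coordinates
  on the base.\<close>

lemma tangent_transition:
  assumes "c \<in> A" "z \<in> snd c ` (fst c \<inter> fst d) \<times> UNIV" "d \<in> A"
  shows "transition (tangent_chart A c) (tangent_chart A d) z
    = (transition c d (fst z), FD (transition c d) (fst z) (snd z))"
proof -
  obtain p u where "p \<in> fst c" "p \<in> fst d" "z = (snd c p, u)" using assms(2) by auto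
  then show ?thesis
    using assms
    by (simp add: chart_inv_tangent_chart tangent_chart_apply chart_inv_chart tangent_vector_def charts_at_def)
qed

lemma smooth_atlas_tangent_atlas: "smooth_atlas (tangent_atlas A)"
  unfolding smooth_atlas_def
proof (intro conjI ballI)
  fix C assume "C \<in> tangent_atlas A"
  then show "inj_on (snd C) (fst C)"
    using inj_on_tangent_chart by (auto simp: tangent_atlas_def)
next
  fix C D assume "C \<in> tangent_atlas A" "D \<in> tangent_atlas A"
  then obtain c d where c: "c \<in> A" "C = tangent_chart A c" and d: "d \<in> A" "D = tangent_chart A d"
    by (auto simp: tangent_atlas_def)
  let ?O = "snd c ` (fst c \<inter> fst d)"
  have img: "snd C ` (fst C \<inter> fst D) = ?O \<times> UNIV"
    using tangent_chart_overlap_image[OF c(1)] c d by simp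
  have o: "open (?O \<times> (UNIV :: 'e set))"
    by (intro open_Times open_overlap c d open_UNIV)
  then show "open (snd C ` (fst C \<inter> fst D))"
    by (simp only: img)
  have "smooth_on (\<lambda>z. (transition c d (fst z), FD (transition c d) (fst z) (snd z))) (?O \<times> UNIV)"
    by (intro smooth_on_Pair o smooth_on_compose[OF o smooth_transition[OF c(1) d(1)]]
          smooth_on_FD_apply[OF o smooth_transition[OF c(1) d(1)]]
          smooth_on_bounded_linear[OF o bounded_linear_fst smooth_on_id]
          smooth_on_bounded_linear[OF o bounded_linear_snd smooth_on_id]) auto
  then show "smooth_on (transition C D) (snd C ` (fst C \<inter> fst D))"
    unfolding img
    by (rule smooth_on_cong[OF o, rotated]) (simp only: c d tangent_transition)
qed

lemma atlas_tangent_atlas: "atlas (tangent_atlas A)"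
  by (rule atlas.intro) (rule smooth_atlas_tangent_atlas)

interpretation T: atlas "tangent_atlas A"
  by (rule atlas_tangent_atlas)

lemma carrier_of_tangent_atlas: "carrier_of (tangent_atlas A) = TM A"
  by (auto simp: carrier_of_def tangent_atlas_def TM_def tangent_chart_def)

lemma charts_at_tangent_atlasE:
  assumes "C \<in> charts_at (tangent_atlas A) q"
  obtains c p v where "c \<in> A" "p \<in> fst c" "v \<in> tangent_space A p" "q = (p, v)" "C = tangent_chart A c"
    "snd C q = (snd c p, v c)"
  using assms by (cases q) (auto simp: charts_at_def tangent_atlas_def tangent_chart_domain tangent_chart_apply)

lemma charts_at_tangent_atlas_TM: "C \<in> charts_at (tangent_atlas A) q \<Longrightarrow> q \<in> TM A"
  using carrier_of_tangent_atlas by (auto simp: charts_at_def carrier_of_def)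

lemma TM_ex_chart:
  assumes "q \<in> TM A"
  obtains C where "C \<in> charts_at (tangent_atlas A) q"
proof -
  have "q \<in> carrier_of (tangent_atlas A)"
    using assms carrier_of_tangent_atlas by blast
  then show ?thesis
    unfolding carrier_of_def using that charts_atI by blast
qed

text \<open>The Jacobian of a change of induced coordinates is block triangular with equal diagonal blocks \<open>F\<close>. The zero
  block makes verticality independent of the chart, and the equality of the two diagonal blocks does the same for \<open>J\<close>.\<close>

lemma FD_tangent_transition:
  assumes "C \<in> charts_at (tangent_atlas A) q" "D \<in> charts_at (tangent_atlas A) q"
  shows "\<exists>F. linear F \<and> (\<forall>u. fst (FD (transition C D) (snd C q) u) = F (fst u)) \<and>
    (\<forall>b. FD (transition C D) (snd C q) (0, b) = (0, F b))"
proof -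
  obtain c p v where c: "c \<in> A" "p \<in> fst c" "v \<in> tangent_space A p" "q = (p, v)" "C = tangent_chart A c"
    "snd C q = (snd c p, v c)"
    using charts_at_tangent_atlasE[OF assms(1)] .
  obtain d where d: "d \<in> A" "p \<in> fst d" "D = tangent_chart A d"
    using charts_at_tangent_atlasE[OF assms(2)] c(4) by (metis Pair_inject)
  let ?t = "transition c d" and ?O = "snd c ` (fst c \<inter> fst d)" and ?x = "snd c p"
  have o: "open (?O \<times> (UNIV :: 'e set))"
    by (intro open_Times open_overlap c d open_UNIV)
  have x: "?x \<in> ?O" using c d by blast
  have dT: "(transition C D has_derivative FD (transition C D) (?x, v c)) (at (?x, v c))"
    using FD_works[OF T.differentiable_transition[of C D q]] assms c(6) by (simp add: charts_at_def)
  have dt: "(?t has_derivative FD ?t ?x) (at ?x)"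
    by (intro FD_works differentiable_transition c d)
  have bl: "bounded_linear (FD ?t ?x)"
    using dt has_derivative_bounded_linear by blast
  have eq: "transition C D z = (?t (fst z), FD ?t (fst z) (snd z))" if "z \<in> ?O \<times> UNIV" for z
    using tangent_transition[OF c(1) that d(1)] c d by simp
  show ?thesis
  proof (intro exI[of _ "FD ?t ?x"] conjI allI)
    show "linear (FD ?t ?x)"
      by (rule bounded_linear.linear[OF bl])
    show "fst (FD (transition C D) (snd C q) u) = FD ?t ?x (fst u)" for u
    proof -
      have "((\<lambda>z. fst (transition C D z)) has_derivative (\<lambda>u. fst (FD (transition C D) (?x, v c) u))) (at (?x, v c))"
        by (rule has_derivative_fst[OF dT])
      moreover have "((\<lambda>z. ?t (fst z)) has_derivative (\<lambda>u. FD ?t ?x (fst u))) (at (?x, v c))"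
      proof (rule has_derivative_compose[where f = fst and f' = fst])
        show "(fst has_derivative fst) (at (?x, v c))"
          by (rule bounded_linear_imp_has_derivative[OF bounded_linear_fst])
        show "(?t has_derivative FD ?t ?x) (at (fst (?x, v c)))"
          using dt by (simp only: fst_conv)
      qed
      then have "((\<lambda>z. fst (transition C D z)) has_derivative (\<lambda>u. FD ?t ?x (fst u))) (at (?x, v c))"
        by (rule has_derivative_transform_within_open[OF _ o]) (use x in \<open>simp_all add: eq del: o_apply\<close>)
      ultimately have "(\<lambda>u. fst (FD (transition C D) (?x, v c) u)) = (\<lambda>u. FD ?t ?x (fst u))"
        by (rule has_derivative_unique)
      then show ?thesis
        unfolding c(6) by (rule fun_cong)
    qed
    show "FD (transition C D) (snd C q) (0, b) = (0, FD ?t ?x b)" for b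
    proof -
      \<comment> \<open>along a fibre the coordinate change is affine, with linear part \<open>D\<tau>(x)\<close>\<close>
      have "((\<lambda>y. transition C D (?x, y)) has_derivative (\<lambda>b. FD (transition C D) (?x, v c) (0, b))) (at (v c))"
      proof (rule has_derivative_compose[where f = "\<lambda>y. (?x, y)" and f' = "\<lambda>b. (0, b)"])
        show "((\<lambda>y. (?x, y)) has_derivative (\<lambda>b. (0, b))) (at (v c))"
          by (intro has_derivative_Pair has_derivative_const has_derivative_ident)
      qed (rule dT)
      moreover have "((\<lambda>y. (?t ?x, FD ?t ?x y)) has_derivative (\<lambda>b. (0, FD ?t ?x b))) (at (v c))"
        by (intro has_derivative_Pair has_derivative_const bounded_linear_imp_has_derivative bl)
      moreover have "(\<lambda>y. transition C D (?x, y)) = (\<lambda>y. (?t ?x, FD ?t ?x y))"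
        using eq x by auto
      ultimately have "(\<lambda>b. FD (transition C D) (?x, v c) (0, b)) = (\<lambda>b. (0, FD ?t ?x b))"
        using has_derivative_unique by metis
      then show ?thesis
        unfolding c(6) by (rule fun_cong)
    qed
  qed
qed

lemma J_in_TTM:
  assumes "w \<in> TTM A q"
  shows "J q w \<in> TTM A q"
proof (rule T.tangent_spaceI)
  fix C assume "C \<notin> charts_at (tangent_atlas A) q"
  then show "J q w C = 0"
    using T.tangent_space_outside[OF assms] by (simp add: J_def zero_prod_def)
next
  fix C D assume CD: "C \<in> charts_at (tangent_atlas A) q" "D \<in> charts_at (tangent_atlas A) q"
  obtain F where F: "linear F" "\<And>u. fst (FD (transition C D) (snd C q) u) = F (fst u)"
    "\<And>b. FD (transition C D) (snd C q) (0, b) = (0, F b)"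
    using FD_tangent_transition[OF CD] by (elim exE conjE) (rule that, blast+)
  have "w D = FD (transition C D) (snd C q) (w C)"
    by (rule T.tangent_space_transition[OF assms CD])
  then show "J q w D = FD (transition C D) (snd C q) (J q w C)"
    by (simp only: J_def F)
qed

lemma vertical_iff:
  assumes "w \<in> TTM A q" "C \<in> charts_at (tangent_atlas A) q"
  shows "vertical w \<longleftrightarrow> fst (w C) = 0"
proof
  assume 0: "fst (w C) = 0"
  have "fst (w D) = 0" for D
  proof (cases "D \<in> charts_at (tangent_atlas A) q")
    case True
    obtain F where F: "linear F" "\<And>u. fst (FD (transition C D) (snd C q) u) = F (fst u)"
      "\<And>b. FD (transition C D) (snd C q) (0, b) = (0, F b)"
      using FD_tangent_transition[OF assms(2) True] by (elim exE conjE) (rule that, blast+)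
    have "w D = FD (transition C D) (snd C q) (w C)"
      by (rule T.tangent_space_transition[OF assms True])
    then show ?thesis
      by (simp only: F(2) 0 linear_0[OF F(1)])
  qed (simp add: T.tangent_space_outside[OF assms(1)])
  then show "vertical w"
    by (simp add: vertical_def)
qed (simp only: vertical_def)

lemma vertical_in_image_J:
  assumes "w \<in> TTM A q" "vertical w" "q \<in> TM A"
  obtains u where "u \<in> TTM A q" "w = J q u"
proof -
  obtain C where C: "C \<in> charts_at (tangent_atlas A) q"
    using TM_ex_chart[OF assms(3)] .
  let ?u = "tangent_vector (tangent_atlas A) C q (snd (w C), 0)"
  have u: "?u \<in> TTM A q" "?u C = (snd (w C), 0)"
    using T.tangent_vector_in_tangent_space T.tangent_vector_chart C by (simp_all add: charts_at_def)
  have "w = J q ?u"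
  proof (rule T.tangent_space_eqI[OF assms(1) J_in_TTM[OF u(1)] C])
    show "w C = J q ?u C"
      using spec[OF assms(2)[unfolded vertical_def], of C] u(2) by (simp add: J_def prod_eq_iff)
  qed
  then show ?thesis
    using that u(1) by blast
qed

text \<open>In induced coordinates \<open>J\<close> is constant, so in \<open>[JX, Y] - J[X, Y]\<close> the derivatives of \<open>X\<close> cancel, leaving
  \<open>DY(Jw) - J(DY w)\<close> with \<open>w = X q\<close>. Once more \<open>Y\<close> need only be differentiable at the point, so that the
  formula covers the canonical spray on the zero section.\<close>

lemma vform_bracket_J:
  assumes Y: "differentiable_vfield_at (tangent_atlas A) q Y" and w: "w \<in> TTM A q" and q: "q \<in> TM A"
  shows "C \<in> charts_at (tangent_atlas A) q \<Longrightarrow> vform_bracket (tangent_atlas A) J Y q w C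
      = FD (coord_field Y C) (snd C q) (0, fst (w C)) - (0, fst (FD (coord_field Y C) (snd C q) (w C)))"
    and "vform_bracket (tangent_atlas A) J Y q w \<in> TTM A q"
proof -
  define Z where "Z C = (if C \<in> charts_at (tangent_atlas A) q
    then FD (coord_field Y C) (snd C q) (0, fst (w C)) - (0, fst (FD (coord_field Y C) (snd C q) (w C)))
    else 0)" for C
  have dJX: "((\<lambda>x. J (chart_inv C x) (X (chart_inv C x)) C) has_derivative
      (\<lambda>u. (0, fst (FD (coord_field X C) (snd C q) u)))) (at (snd C q))"
    if "differentiable_vfield_at (tangent_atlas A) q X" "C \<in> charts_at (tangent_atlas A) q" for X C
    unfolding J_def using that unfolding differentiable_vfield_at_def
    by (intro has_derivative_Pair has_derivative_const has_derivative_fst FD_works) auto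
  have eq: "(\<lambda>C. lie_bracket (tangent_atlas A) (\<lambda>r. J r (X r)) Y q C
      - J q (lie_bracket (tangent_atlas A) X Y q) C) = Z"
    if X: "differentiable_vfield_at (tangent_atlas A) q X" "X q = w" for X
  proof
    fix C
    show "lie_bracket (tangent_atlas A) (\<lambda>r. J r (X r)) Y q C - J q (lie_bracket (tangent_atlas A) X Y q) C = Z C"
    proof (cases "C \<in> charts_at (tangent_atlas A) q")
      case True
      have FDJ: "FD (\<lambda>x. J (chart_inv C x) (X (chart_inv C x)) C) (snd C q) u
          = (0, fst (FD (coord_field X C) (snd C q) u))" for u
        using FD_eq[OF dJX[OF X(1) True]] by simp
      show ?thesis
        using True by (simp add: lie_bracket_def FDJ Z_def) (simp add: J_def X(2) prod_eq_iff)
    next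
      case False
      then show ?thesis
        by (simp add: lie_bracket_def J_def Z_def zero_prod_def)
    qed
  qed
  obtain C0 where "C0 \<in> charts_at (tangent_atlas A) q"
    using TM_ex_chart[OF q] .
  then obtain X where X: "smooth_vfield_near (tangent_atlas A) q X" "X q = w"
    using T.ex_smooth_vfield_extension[OF _ w] by blast
  have Z: "vform_bracket (tangent_atlas A) J Y q w = Z"
    unfolding vform_bracket_def
  proof (rule the_equality)
    show "\<forall>X. smooth_vfield_near (tangent_atlas A) q X \<and> X q = w \<longrightarrow>
        Z = (\<lambda>C. lie_bracket (tangent_atlas A) (\<lambda>r. J r (X r)) Y q C - J q (lie_bracket (tangent_atlas A) X Y q) C)"
      using eq[OF T.smooth_vfield_near_differentiable, symmetric] by blast
    show "z = Z" if "\<forall>X. smooth_vfield_near (tangent_atlas A) q X \<and> X q = w \<longrightarrow>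
        z = (\<lambda>C. lie_bracket (tangent_atlas A) (\<lambda>r. J r (X r)) Y q C - J q (lie_bracket (tangent_atlas A) X Y q) C)" for z
      unfolding eq[OF T.smooth_vfield_near_differentiable[OF X(1)] X(2), symmetric]
      by (rule that[rule_format]) (simp add: X)
  qed
  show "C \<in> charts_at (tangent_atlas A) q \<Longrightarrow> vform_bracket (tangent_atlas A) J Y q w C
      = FD (coord_field Y C) (snd C q) (0, fst (w C)) - (0, fst (FD (coord_field Y C) (snd C q) (w C)))"
    by (simp add: Z Z_def)
  have dX: "differentiable_vfield_at (tangent_atlas A) q X"
    by (rule T.smooth_vfield_near_differentiable[OF X(1)])
  have dJX': "differentiable_vfield_at (tangent_atlas A) q (\<lambda>r. J r (X r))"
  proof -
    have "coord_field (\<lambda>r. J r (X r)) C differentiable at (snd C q)"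
      if "C \<in> charts_at (tangent_atlas A) q" for C
      using dJX[OF dX that] differentiable_def by blast
    then show ?thesis
      using dX J_in_TTM unfolding differentiable_vfield_at_def by blast
  qed
  have "(\<lambda>C. lie_bracket (tangent_atlas A) (\<lambda>r. J r (X r)) Y q C
      - J q (lie_bracket (tangent_atlas A) X Y q) C) \<in> TTM A q"
    by (intro T.tangent_space_diff T.lie_bracket_in_tangent_space J_in_TTM dX dJX' Y)
  then show "vform_bracket (tangent_atlas A) J Y q w \<in> TTM A q"
    by (simp only: Z eq[OF dX X(2)])
qed

lemma tangent_chart_image_TM0:
  assumes "c \<in> A"
  shows "snd (tangent_chart A c) ` (fst (tangent_chart A c) \<inter> TM0 A) = snd c ` fst c \<times> (- {0})"
proof (intro equalityI subsetI)
  fix z assume "z \<in> snd (tangent_chart A c) ` (fst (tangent_chart A c) \<inter> TM0 A)"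
  then obtain p v where pv: "p \<in> fst c" "v \<in> tangent_space A p" "v \<noteq> tzero" "z = (snd c p, v c)"
    by (auto simp: tangent_chart_domain tangent_chart_apply TM0_def)
  then have "v c \<noteq> 0"
    using tangent_space_eqI[OF pv(2) tzero_in_tangent_space, of c] assms by auto
  then show "z \<in> snd c ` fst c \<times> (- {0})"
    using pv by auto
next
  fix z assume "z \<in> snd c ` fst c \<times> (- {0 :: 'e})"
  then obtain p u where p: "p \<in> fst c" "z = (snd c p, u)" "u \<noteq> 0" by auto
  have v: "tangent_vector A c p u \<in> tangent_space A p" "tangent_vector A c p u c = u"
    using p assms by (simp_all add: tangent_vector_in_tangent_space tangent_vector_chart)
  then have "(p, tangent_vector A c p u) \<in> fst (tangent_chart A c) \<inter> TM0 A"
    using p assms by (auto simp: tangent_chart_domain TM0_def TM_def carrier_of_def)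
  moreover have "z = snd (tangent_chart A c) (p, tangent_vector A c p u)"
    using p v by (simp add: tangent_chart_apply)
  ultimately show "z \<in> snd (tangent_chart A c) ` (fst (tangent_chart A c) \<inter> TM0 A)"
    by blast
qed

lemma manifold_open_TM0: "manifold_open (tangent_atlas A) (TM0 A)"
proof -
  have "open (snd C ` (fst C \<inter> TM0 A))" if "C \<in> tangent_atlas A" for C
  proof -
    obtain c where c: "c \<in> A" "C = tangent_chart A c"
      using \<open>C \<in> tangent_atlas A\<close> by (auto simp: tangent_atlas_def)
    have "open (snd c ` fst c \<times> (- {0 :: 'e}))"
      by (intro open_Times open_chart_image c open_Compl closed_singleton)
    then show ?thesis
      by (simp only: c(2) tangent_chart_image_TM0[OF c(1)])
  qed
  moreover have "TM0 A \<subseteq> carrier_of (tangent_atlas A)"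
    unfolding carrier_of_tangent_atlas by (auto simp: TM0_def)
  ultimately show ?thesis
    by (simp add: manifold_open_def)
qed

end

section \<open>The spray of a homogeneous function in a chart\<close>

text \<open>A function on an open set of coordinates \<open>(x, y)\<close> with the properties of an energy function off the zero
  section. The hypothesis \<open>nondegenerate\<close> concerns the coordinate expression of the fundamental form.\<close>

locale local_energy =
  fixes U :: "'e::euclidean_space set" and e :: "'e \<times> 'e \<Rightarrow> real"
  assumes open_U: "open U"
    and smooth: "smooth_on e (U \<times> (- {0}))"
    and homogeneous: "\<And>x y t. x \<in> U \<Longrightarrow> t > 0 \<Longrightarrow> e (x, t *\<^sub>R y) = t\<^sup>2 * e (x, y)"
    and nondegenerate: "\<And>z v. z \<in> U \<times> (- {0}) \<Longrightarrow>
      (\<And>w. FD (\<lambda>z. FD e z (0, fst w)) z v - FD (\<lambda>z. FD e z (0, fst v)) z w = 0) \<Longrightarrow> v = 0"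
begin

text \<open>The second derivative of the energy, with \<open>u\<close> the direction of the outer differentiation.\<close>

definition hess :: "'e \<times> 'e \<Rightarrow> 'e \<times> 'e \<Rightarrow> 'e \<times> 'e \<Rightarrow> real" where
  "hess z u v = FD (\<lambda>z. FD e z v) z u"

text \<open>The fundamental form \<open>d d\<^sub>J E\<close> in induced coordinates, where \<open>J v = (0, fst v)\<close>.\<close>

definition omega :: "'e \<times> 'e \<Rightarrow> 'e \<times> 'e \<Rightarrow> 'e \<times> 'e \<Rightarrow> real" where
  "omega z v w = hess z v (0, fst w) - hess z w (0, fst v)"

text \<open>The coordinate expression of \<open>-(dE)\<^sup>#\<close>, extended by \<open>0\<close> to the zero section.\<close>

definition spray :: "'e \<times> 'e \<Rightarrow> 'e \<times> 'e" where
  "spray z = (if snd z = 0 then 0 else THE s. \<forall>w. omega z s w = - FD e z w)"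

lemma open_slit: "open (U \<times> (- {0 :: 'e}))"
  by (intro open_Times open_U open_Compl closed_singleton)

lemma e_has_derivative: "z \<in> U \<times> (- {0}) \<Longrightarrow> (e has_derivative FD e z) (at z)"
  by (rule FD_works[OF smooth_on_imp_differentiable[OF smooth]])

lemma linear_FD_e: "z \<in> U \<times> (- {0}) \<Longrightarrow> linear (FD e z)"
  by (rule has_derivative_linear[OF e_has_derivative])

lemma FD_e_has_derivative: "z \<in> U \<times> (- {0}) \<Longrightarrow> ((\<lambda>z. FD e z v) has_derivative (\<lambda>u. hess z u v)) (at z)"
  unfolding hess_def by (rule FD_works[OF smooth_on_imp_differentiable[OF smooth_on_FD[OF smooth]]])

lemma hess_sym: "z \<in> U \<times> (- {0}) \<Longrightarrow> hess z u v = hess z v u"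
  unfolding hess_def by (rule symmetric_second_derivative[OF open_slit smooth])

lemma linear_hess_left: "z \<in> U \<times> (- {0}) \<Longrightarrow> linear (\<lambda>u. hess z u v)"
  by (rule has_derivative_linear[OF FD_e_has_derivative])

lemma linear_hess_right: "z \<in> U \<times> (- {0}) \<Longrightarrow> linear (hess z u)"
  using linear_hess_left[of z u] by (simp add: hess_sym[of z _ u] eta_contract_eq)

lemma linear_omega_left:
  assumes "z \<in> U \<times> (- {0})"
  shows "linear (\<lambda>v. omega z v w)"
proof -
  have l: "linear (\<lambda>v::'e \<times> 'e. (0::'e, fst v))"
    by (intro linearI) auto
  have "linear (\<lambda>v::'e \<times> 'e. hess z w (0, fst v))"
    using linear_compose[OF l linear_hess_right[OF assms, of w]] by (simp add: o_def)
  then show ?thesis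
    unfolding omega_def by (rule linear_compose_sub[OF linear_hess_left[OF assms]])
qed

lemma linear_omega_right:
  assumes "z \<in> U \<times> (- {0})"
  shows "linear (omega z v)"
proof -
  have "linear (\<lambda>w. - omega z w v)"
    by (rule linear_compose_neg[OF linear_omega_left[OF assms]])
  then show ?thesis
    by (simp add: omega_def[abs_def])
qed

lemma omega_nondegenerate: "z \<in> U \<times> (- {0}) \<Longrightarrow> (\<And>w. omega z v w = 0) \<Longrightarrow> v = 0"
  using nondegenerate by (simp add: omega_def hess_def)

lemma inner_Basis_representation:
  fixes f :: "'e \<times> 'e \<Rightarrow> real"
  assumes "linear f"
  shows "(\<Sum>b\<in>Basis. f b *\<^sub>R b) \<bullet> w = f w"
proof -
  have "(\<Sum>b\<in>Basis. f b *\<^sub>R b) \<bullet> w = (\<Sum>b\<in>Basis. (w \<bullet> b) *\<^sub>R f b)"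
    by (simp add: inner_sum_left inner_commute[of w] mult.commute)
  then show ?thesis
    using linear_Basis_expansion[OF assms, of w] by simp
qed

text \<open>The map \<open>v \<mapsto> \<omega>(v, \<cdot>)\<close>, with covectors identified with vectors through the inner product.\<close>

lemma omega_flat_linear_inj:
  assumes "z \<in> U \<times> (- {0})"
  shows "linear (\<lambda>v. \<Sum>b\<in>Basis. omega z v b *\<^sub>R b)" "inj (\<lambda>v. \<Sum>b\<in>Basis. omega z v b *\<^sub>R b)"
proof -
  show lin: "linear (\<lambda>v. \<Sum>b\<in>Basis. omega z v b *\<^sub>R b)"
    by (rule linearI)
       (simp_all add: linear_add[OF linear_omega_left[OF assms]] linear_scale[OF linear_omega_left[OF assms]]
          scaleR_left_distrib sum.distrib scaleR_sum_right)
  have "v = 0" if "(\<Sum>b\<in>Basis. omega z v b *\<^sub>R b) = 0" for v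
    using inner_Basis_representation[OF linear_omega_right[OF assms], of v] that
    by (intro omega_nondegenerate[OF assms]) simp
  then show "inj (\<lambda>v. \<Sum>b\<in>Basis. omega z v b *\<^sub>R b)"
    by (subst linear_injective_0[OF lin]) blast
qed

lemma omega_representation:
  assumes "z \<in> U \<times> (- {0})" "linear f"
  shows "\<exists>!s. \<forall>w. omega z s w = f w"
proof -
  let ?B = "\<lambda>v. \<Sum>b\<in>Basis. omega z v b *\<^sub>R b"
  obtain G where "\<And>v. ?B (G v) = v"
    using linear_injective_isomorphism[OF omega_flat_linear_inj[OF assms(1)]] by blast
  then obtain s where s: "?B s = (\<Sum>b\<in>Basis. f b *\<^sub>R b)"
    by blast
  have "omega z s w = f w" for w
    using inner_Basis_representation[OF linear_omega_right[OF assms(1)], of s w]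
      inner_Basis_representation[OF assms(2), of w] by (simp add: s)
  moreover have "r = s" if "\<forall>w. omega z r w = f w" for r
  proof -
    have "omega z (r - s) w = 0" for w
      using spec[OF that, of w] \<open>omega z s w = f w\<close> by (simp add: linear_diff[OF linear_omega_left[OF assms(1)]])
    then have "r - s = 0"
      by (rule omega_nondegenerate[OF assms(1)])
    then show ?thesis by simp
  qed
  ultimately show ?thesis by blast
qed

lemma spray_eq_The: "z \<in> U \<times> (- {0}) \<Longrightarrow> spray z = (THE s. \<forall>w. omega z s w = - FD e z w)"
  by (auto simp: spray_def simp del: split_paired_All)

lemma ex1_spray: "z \<in> U \<times> (- {0}) \<Longrightarrow> \<exists>!s. \<forall>w. omega z s w = - FD e z w"
  by (rule omega_representation[OF _ linear_compose_neg[OF linear_FD_e]])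

lemma omega_spray:
  assumes "z \<in> U \<times> (- {0})"
  shows "omega z (spray z) w = - FD e z w"
  using theI'[OF ex1_spray[OF assms]] unfolding spray_eq_The[OF assms, symmetric] by (rule spec)

lemma spray_unique:
  assumes "z \<in> U \<times> (- {0})" "\<And>w. omega z s w = - FD e z w"
  shows "spray z = s"
  using ex1_spray[OF assms(1)] omega_spray[OF assms(1)] assms(2) by blast

text \<open>The spray solves a linear system whose coefficients are second derivatives of the energy.\<close>

lemma smooth_spray: "smooth_on spray (U \<times> (- {0}))"
proof (unfold smooth_on_def, rule allI)
  fix k
  let ?B = "\<lambda>z v. \<Sum>b\<in>Basis. omega z v b *\<^sub>R b" and ?f = "\<lambda>z. \<Sum>b\<in>Basis. (- FD e z b) *\<^sub>R b"
  have "smooth_on (\<lambda>z. omega z v b) (U \<times> (- {0}))" for v b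
    unfolding omega_def hess_def by (intro smooth_on_diff open_slit smooth_on_FD smooth)
  then have "smooth_on (\<lambda>z. ?B z v) (U \<times> (- {0}))" for v
    by (intro smooth_on_sum open_slit smooth_on_bilinear[OF _ bounded_bilinear_scaleR] smooth_on_const)
  moreover have "smooth_on ?f (U \<times> (- {0}))"
    by (intro smooth_on_sum open_slit smooth_on_bilinear[OF _ bounded_bilinear_scaleR] smooth_on_const
        smooth_on_minus smooth_on_FD smooth)
  moreover have "?B z (spray z) = ?f z" if "z \<in> U \<times> (- {0})" for z
    using omega_spray[OF that] by simp
  ultimately show "Ck_on k spray (U \<times> (- {0}))"
    using Ck_on_linear_system[OF open_slit, where B = ?B and s = spray and f = ?f and k = k]
      omega_flat_linear_inj by (simp add: smooth_on_def)
qed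

text \<open>The homogeneity relation differentiated with respect to the factor \<open>t\<close> at \<open>t = 1\<close>.\<close>

lemma Euler: 
  assumes "z \<in> U \<times> (- {0})"
  shows "FD e z (0, snd z) = 2 * e z"
proof -
  obtain x y where z: "z = (x, y)" by (cases z)
  have "((\<lambda>t. e (x, t *\<^sub>R y)) has_real_derivative FD e (x, 1 *\<^sub>R y) (0, y)) (at 1)"
    by (rule has_real_derivative_along_line)
       (use assms z in \<open>auto intro!: derivative_eq_intros smooth_on_imp_differentiable[OF smooth]\<close>)
  moreover have "((\<lambda>t. e (x, t *\<^sub>R y)) has_real_derivative 2 * e (x, y)) (at 1)"
  proof (rule has_field_derivative_transform_within_open[where S = "{0<..}"])
    show "((\<lambda>t. t\<^sup>2 * e (x, y)) has_real_derivative 2 * e (x, y)) (at 1)"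
      by (auto intro!: derivative_eq_intros)
  qed (use homogeneous assms z in auto)
  ultimately show ?thesis
    using DERIV_unique z by fastforce
qed

text \<open>The derivative of Euler's relation \<open>de(0, y) = 2 e\<close> in the direction \<open>u\<close>.\<close>

lemma Euler_derivative:
  assumes "z \<in> U \<times> (- {0})"
  shows "hess z u (0, snd z) = 2 * FD e z u - FD e z (0, snd u)"
proof -
  have "((\<lambda>z. (0::'e, snd z)) has_derivative (\<lambda>u. (0, snd u))) (at z)" for z :: "'e \<times> 'e"
    by (intro has_derivative_Pair has_derivative_const has_derivative_snd has_derivative_ident)
  then have d: "(\<lambda>z. (0::'e, snd z)) differentiable at z" "FD (\<lambda>z. (0::'e, snd z)) z = (\<lambda>u. (0, snd u))"
    for z :: "'e \<times> 'e"
    by (rule differentiableI, rule FD_eq)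
  have "((\<lambda>z. FD e z (0, snd z)) has_derivative (\<lambda>u. FD e z (0, snd u) + hess z u (0, snd z))) (at z)"
    using has_derivative_FD_apply[OF open_slit assms smooth d(1)] by (simp add: d(2) hess_def)
  moreover have "((\<lambda>z. FD e z (0, snd z)) has_derivative (\<lambda>u. 2 * FD e z u)) (at z)"
  proof (rule has_derivative_transform_within_open[OF _ open_slit assms])
    show "((\<lambda>z. 2 * e z) has_derivative (\<lambda>u. 2 * FD e z u)) (at z)"
      by (intro has_derivative_mult_right e_has_derivative assms)
  qed (simp add: Euler)
  ultimately have "(\<lambda>u. FD e z (0, snd u) + hess z u (0, snd z)) = (\<lambda>u. 2 * FD e z u)"
    by (rule has_derivative_unique)
  then have "FD e z (0, snd u) + hess z u (0, snd z) = 2 * FD e z u"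
    by (rule fun_cong)
  then show ?thesis by simp
qed

text \<open>The spray is a second-order field: \<open>J S\<close> is the Liouville field \<open>C = (0, y)\<close>. On vertical vectors the
  equation of \<open>S\<close> says \<open>hess (0, a) (J S) = de(0, a)\<close>, and Euler's relation says the same of \<open>C\<close>. So \<open>J S - C\<close>,
  being vertical, is \<open>\<omega>\<close>-orthogonal to everything.\<close>

lemma fst_spray:
  assumes "x \<in> U"
  shows "fst (spray (x, y)) = y"
proof (cases "y = 0")
  case False
  let ?z = "(x, y)" and ?k = "fst (spray (x, y)) - y"
  have z: "?z \<in> U \<times> (- {0})" using False assms by simp
  have "hess ?z (0, a) (0, ?k) = 0" for a
  proof -
    have "(0::'e, ?k) = (0, fst (spray ?z)) - (0, y)" by simp
    then have "hess ?z (0, a) (0, ?k) = hess ?z (0, a) (0, fst (spray ?z)) - hess ?z (0, a) (0, y)"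
      by (simp only: linear_diff[OF linear_hess_right[OF z]])
    moreover have "hess ?z (0, a) (0, fst (spray ?z)) = FD e ?z (0, a)"
      using omega_spray[OF z, of "(0, a)"] linear_0[OF linear_hess_right[OF z]]
      by (simp add: omega_def zero_prod_def)
    moreover have "hess ?z (0, a) (0, y) = FD e ?z (0, a)"
      using Euler_derivative[OF z, of "(0, a)"] by simp
    ultimately show ?thesis by simp
  qed
  then have "hess ?z (0, ?k) (0, fst w) = 0" for w :: "'e \<times> 'e"
    using hess_sym[OF z, of "(0, ?k)"] by simp
  moreover have "(0::'e, fst (0::'e, ?k)) = 0"
    by (simp add: zero_prod_def)
  then have "hess ?z w (0, fst (0::'e, ?k)) = 0" for w
    by (simp only: linear_0[OF linear_hess_right[OF z]])
  ultimately have "omega ?z (0, ?k) w = 0" for w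
    by (simp only: omega_def diff_self)
  then have "(0::'e, ?k) = 0"
    by (rule omega_nondegenerate[OF z])
  then show ?thesis
    by (simp add: zero_prod_def)
qed (simp add: spray_def)

text \<open>The equation of the spray on the horizontal coordinate vector \<open>(a, 0)\<close>, in which \<open>J S\<close> is the Liouville field,
  simplified by the derivative of Euler's relation.\<close>

lemma hess_spray_vertical:
  assumes "z \<in> U \<times> (- {0})"
  shows "hess z (spray z) (0, a) = FD e z (a, 0)"
proof -
  have "fst (spray z) = snd z"
    using fst_spray[of "fst z" "snd z"] assms by auto
  then have "hess z (spray z) (0, a) = hess z (a, 0) (0, snd z) - FD e z (a, 0)"
    using omega_spray[OF assms, of "(a, 0)"] by (simp add: omega_def)
  then show ?thesis
    using Euler_derivative[OF assms, of "(a, 0)"] linear_0[OF linear_FD_e[OF assms]]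
    by (simp add: zero_prod_def)
qed

lemma spray_conserves_energy:
  assumes "z \<in> U \<times> (- {0})"
  shows "FD e z (spray z) = 0"
  using omega_spray[OF assms, of "spray z"] by (simp add: omega_def)

text \<open>The heart of the matter: conservation of energy along the spray, \<open>de(S) = 0\<close>, is differentiated in a vertical
  direction, and the term with the second derivative is known from the equation of the spray.\<close>

lemma FD_e_FD_spray_vertical:
  assumes "z \<in> U \<times> (- {0})"
  shows "FD e z (FD spray z (0, a)) = - FD e z (a, 0)"
proof -
  have "((\<lambda>z. FD e z (spray z)) has_derivative
      (\<lambda>u. FD e z (FD spray z u) + hess z u (spray z))) (at z)"
    unfolding hess_def
    by (rule has_derivative_FD_apply[OF open_slit assms smooth smooth_on_imp_differentiable[OF smooth_spray assms]])
  moreover have "((\<lambda>z. FD e z (spray z)) has_derivative (\<lambda>u. 0)) (at z)"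
    by (rule has_derivative_transform_within_open[OF has_derivative_const open_slit assms])
       (simp add: spray_conserves_energy)
  ultimately have "(\<lambda>u. FD e z (FD spray z u) + hess z u (spray z)) = (\<lambda>u. 0)"
    by (rule has_derivative_unique)
  then have "FD e z (FD spray z (0, a)) + hess z (0, a) (spray z) = 0"
    by (rule fun_cong)
  then show ?thesis
    using hess_spray_vertical[OF assms, of a] hess_sym[OF assms] by simp
qed

text \<open>Homogeneity of the energy, transported to its first derivative by the chain rule for the fibre
  dilation \<open>(x, y) \<mapsto> (x, t y)\<close>.\<close>

lemma FD_scaling:
  assumes "z \<in> U \<times> (- {0})" "t > 0"
  shows "FD e (fst z, t *\<^sub>R snd z) (fst u, t *\<^sub>R snd u) = t\<^sup>2 * FD e z u"
proof -
  let ?M = "\<lambda>z::'e \<times> 'e. (fst z, t *\<^sub>R snd z)"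
  have M: "?M z \<in> U \<times> (- {0})" using assms by auto
  have dM: "(?M has_derivative ?M) (at z)"
    by (intro has_derivative_Pair has_derivative_fst has_derivative_scaleR_right has_derivative_snd has_derivative_ident)
  have "((\<lambda>z. e (?M z)) has_derivative (\<lambda>u. FD e (?M z) (?M u))) (at z)"
    by (rule has_derivative_compose[where f = ?M and f' = ?M, OF dM e_has_derivative[OF M]])
  moreover have "((\<lambda>z. e (?M z)) has_derivative (\<lambda>u. t\<^sup>2 * FD e z u)) (at z)"
  proof (rule has_derivative_transform_within_open[OF _ open_slit assms(1)])
    show "((\<lambda>z. t\<^sup>2 * e z) has_derivative (\<lambda>u. t\<^sup>2 * FD e z u)) (at z)"
      by (intro has_derivative_mult_right e_has_derivative assms)
  qed (use homogeneous assms(2) in auto)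
  ultimately have "(\<lambda>u. FD e (?M z) (?M u)) = (\<lambda>u. t\<^sup>2 * FD e z u)"
    by (rule has_derivative_unique)
  then show ?thesis
    by (rule fun_cong)
qed

lemma hess_scaling:
  assumes "z \<in> U \<times> (- {0})" "t > 0"
  shows "hess (fst z, t *\<^sub>R snd z) (fst u, t *\<^sub>R snd u) (fst v, t *\<^sub>R snd v) = t\<^sup>2 * hess z u v"
proof -
  let ?M = "\<lambda>z::'e \<times> 'e. (fst z, t *\<^sub>R snd z)"
  have M: "?M z \<in> U \<times> (- {0})" using assms by auto
  have dM: "(?M has_derivative ?M) (at z)"
    by (intro has_derivative_Pair has_derivative_fst has_derivative_scaleR_right has_derivative_snd has_derivative_ident)
  have "((\<lambda>z. FD e (?M z) (?M v)) has_derivative (\<lambda>u. hess (?M z) (?M u) (?M v))) (at z)"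
    by (rule has_derivative_compose[where f = ?M and f' = ?M and g = "\<lambda>z. FD e z (?M v)", OF dM FD_e_has_derivative[OF M]])
  moreover have "((\<lambda>z. FD e (?M z) (?M v)) has_derivative (\<lambda>u. t\<^sup>2 * hess z u v)) (at z)"
  proof (rule has_derivative_transform_within_open[OF _ open_slit assms(1)])
    show "((\<lambda>z. t\<^sup>2 * FD e z v) has_derivative (\<lambda>u. t\<^sup>2 * hess z u v)) (at z)"
      by (intro has_derivative_mult_right FD_e_has_derivative assms)
  qed (use FD_scaling assms(2) in auto)
  ultimately have "(\<lambda>u. hess (?M z) (?M u) (?M v)) = (\<lambda>u. t\<^sup>2 * hess z u v)"
    by (rule has_derivative_unique)
  then show ?thesis
    by (rule fun_cong)
qed

text \<open>The dilated vector \<open>(t y, t\<^sup>2 g)\<close> satisfies the equation of the spray at \<open>(x, t y)\<close>, by the homogeneity of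
  the derivatives of the energy, and that equation has only one solution.\<close>

lemma snd_spray_scaling:
  assumes "x \<in> U" "y \<noteq> 0" "t > 0"
  shows "snd (spray (x, t *\<^sub>R y)) = t\<^sup>2 *\<^sub>R snd (spray (x, y))"
proof -
  let ?z = "(x, y)" and ?tz = "(x, t *\<^sub>R y)" 
  define g where "g = snd (spray ?z)"
  have z: "?z \<in> U \<times> (- {0})" and tz: "?tz \<in> U \<times> (- {0})"
    using assms by auto
  have s: "spray ?z = (y, g)"
    using fst_spray[OF assms(1), of y] by (simp add: g_def prod_eq_iff)
  have "omega ?tz (t *\<^sub>R y, t\<^sup>2 *\<^sub>R g) w = - FD e ?tz w" for w
  proof -
    \<comment> \<open>every vector is in the image of the fibre dilation, which is invertible\<close>
    obtain a b where w: "w = (a, t *\<^sub>R b)"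
      using that[of "fst w" "snd w /\<^sub>R t"] assms(3) by simp
    have ar: "(t *\<^sub>R y, t\<^sup>2 *\<^sub>R g) = t *\<^sub>R (y, t *\<^sub>R g)"
      by (simp add: power2_eq_square)
    have 1: "hess ?tz (t *\<^sub>R y, t\<^sup>2 *\<^sub>R g) (0, a) = t\<^sup>2 * hess ?z (y, g) (0, a)"
    proof -
      have "hess ?tz (t *\<^sub>R y, t\<^sup>2 *\<^sub>R g) (0, a) = t * hess ?tz (y, t *\<^sub>R g) (0, a)"
        unfolding ar by (simp only: linear_scale[OF linear_hess_left[OF tz]] real_scaleR_def)
      also have "\<dots> = hess ?tz (y, t *\<^sub>R g) (t *\<^sub>R (0, a))"
        using linear_scale[OF linear_hess_right[OF tz], of "(y, t *\<^sub>R g)" t "(0, a)"] by simp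
      also have "\<dots> = t\<^sup>2 * hess ?z (y, g) (0, a)"
        using hess_scaling[OF z assms(3), of "(y, g)" "(0, a)"] by simp
      finally show ?thesis .
    qed
    have 2: "hess ?tz (a, t *\<^sub>R b) (0, t *\<^sub>R y) = t\<^sup>2 * hess ?z (a, b) (0, y)"
      using hess_scaling[OF z assms(3), of "(a, b)" "(0, y)"] by simp
    have 3: "FD e ?tz (a, t *\<^sub>R b) = t\<^sup>2 * FD e ?z (a, b)"
      using FD_scaling[OF z assms(3), of "(a, b)"] by simp
    have 4: "hess ?z (y, g) (0, a) - hess ?z (a, b) (0, y) = - FD e ?z (a, b)"
      using omega_spray[OF z, of "(a, b)"] by (simp add: s omega_def)
    have "omega ?tz (t *\<^sub>R y, t\<^sup>2 *\<^sub>R g) w = t\<^sup>2 * (hess ?z (y, g) (0, a) - hess ?z (a, b) (0, y))"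
      by (simp add: w omega_def 1 2 right_diff_distrib)
    then show ?thesis
      by (simp add: 4 w 3)
  qed
  then have "spray ?tz = (t *\<^sub>R y, t\<^sup>2 *\<^sub>R g)"
    by (rule spray_unique[OF tz])
  then show ?thesis
    by (simp add: g_def)
qed

text \<open>A bound on the unit sphere, by compactness, spreads to all \<open>y\<close> by homogeneity of degree \<open>2\<close>.\<close>

lemma snd_spray_bound:
  assumes "x \<in> U"
  shows "\<exists>r>0. \<exists>K. \<forall>x'\<in>ball x r. \<forall>y. norm (snd (spray (x', y))) \<le> K * (norm y)\<^sup>2"
proof -
  obtain r where r: "r > 0" "cball x r \<subseteq> U"
    using open_U assms open_contains_cball by blast
  have "continuous_on (U \<times> (- {0})) spray"
    using smooth_spray Ck_on_imp_continuous_on by (auto simp: smooth_on_def)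
  then have "continuous_on (cball x r \<times> sphere 0 1) (\<lambda>z. norm (snd (spray z)))"
    using r(2) by (intro continuous_on_norm continuous_on_snd) (auto elim!: continuous_on_subset)
  moreover have "compact (cball x r \<times> sphere (0::'e) 1)"
    by (intro compact_Times compact_cball compact_sphere)
  ultimately have "bounded ((\<lambda>z. norm (snd (spray z))) ` (cball x r \<times> sphere 0 1))"
    by (intro compact_imp_bounded compact_continuous_image)
  then obtain K where K: "\<And>z. z \<in> cball x r \<times> sphere 0 1 \<Longrightarrow> norm (snd (spray z)) \<le> K"
    unfolding bounded_iff by auto
  have "norm (snd (spray (x', y))) \<le> K * (norm y)\<^sup>2" if x': "x' \<in> ball x r" for x' y
  proof (cases "y = 0")
    case False
    have "norm (snd (spray (x', y))) = norm (snd (spray (x', norm y *\<^sub>R sgn y)))"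
      using False by (simp add: sgn_div_norm)
    also have "\<dots> = (norm y)\<^sup>2 * norm (snd (spray (x', sgn y)))"
    proof -
      have "x' \<in> U"
        using x' r(2) ball_subset_cball by blast
      then show ?thesis
        using snd_spray_scaling[of x' "sgn y" "norm y"] False by (simp add: sgn_zero_iff)
    qed
    also have "\<dots> \<le> (norm y)\<^sup>2 * K"
      using K[of "(x', sgn y)"] x' False by (intro mult_left_mono) (auto simp: norm_sgn)
    finally show ?thesis
      by (simp add: mult.commute)
  qed (simp add: spray_def)
  then show ?thesis
    using r(1) by blast
qed

text \<open>Being \<open>O(|y|\<^sup>2)\<close>, the second component of the spray has derivative \<open>0\<close> there. So the bracket with \<open>J\<close> is
  meaningful on the zero section, although the energy itself is only \<open>C\<^sup>1\<close> there.\<close>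

lemma spray_has_derivative_zero_section:
  assumes "x \<in> U"
  shows "(spray has_derivative (\<lambda>u. (snd u, 0))) (at (x, 0))"
proof -
  obtain r K where r: "r > 0"
    and K: "\<And>x' y. x' \<in> ball x r \<Longrightarrow> norm (snd (spray (x', y))) \<le> K * (norm y)\<^sup>2"
    using snd_spray_bound[OF assms] by blast
  have near: "fst z \<in> ball x r" if "dist z (x, 0) < r" for z :: "'e \<times> 'e"
    using dist_fst_le[of z "(x, 0)"] that by (simp add: dist_commute)
  have "((\<lambda>z. snd (spray z)) has_derivative (\<lambda>u. 0)) (at (x, 0))"
  proof (rule has_derivativeI_sandwich[OF r])
    show "bounded_linear (\<lambda>u::'e \<times> 'e. 0::'e)"
      by (rule bounded_linear_zero)
    show "((\<lambda>z. \<bar>K\<bar> * norm (z - (x, 0))) \<longlongrightarrow> 0) (at (x, 0 :: 'e))"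
      by (intro tendsto_mult_right_zero tendsto_norm_zero LIM_zero tendsto_ident_at)
    fix z :: "'e \<times> 'e" assume z: "z \<noteq> (x, 0)" "dist z (x, 0) < r"
    have "norm (snd (spray z)) \<le> \<bar>K\<bar> * (norm (snd z))\<^sup>2"
      using K[OF near[OF z(2)], of "snd z"] by (smt (verit) mult_right_mono prod.collapse zero_le_power2)
    also have "\<dots> \<le> \<bar>K\<bar> * (norm (z - (x, 0)))\<^sup>2"
      using norm_snd_le[of "snd z" "fst z - x"] 
      by (intro mult_left_mono power_mono) (simp_all add: minus_prod_def)
    finally have "norm (snd (spray z)) / norm (z - (x, 0)) \<le> \<bar>K\<bar> * (norm (z - (x, 0)))\<^sup>2 / norm (z - (x, 0))"
      by (rule divide_right_mono) simp
    also have "\<dots> = \<bar>K\<bar> * norm (z - (x, 0))"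
      using z(1) by (simp add: power2_eq_square)
    finally show "norm (snd (spray z) - snd (spray (x, 0)) - 0) / norm (z - (x, 0)) \<le> \<bar>K\<bar> * norm (z - (x, 0))"
      by (simp add: spray_def[of "(x, 0)"])
  qed
  then have "((\<lambda>z. (snd z, snd (spray z))) has_derivative (\<lambda>u. (snd u, 0))) (at (x, 0))"
    by (intro has_derivative_Pair has_derivative_snd has_derivative_ident)
  then show ?thesis
  proof (rule has_derivative_transform_within_open)
    show "open (U \<times> (UNIV :: 'e set))"
      by (intro open_Times open_U open_UNIV)
    show "(snd z, snd (spray z)) = spray z" if "z \<in> U \<times> UNIV" for z
      using fst_spray[of "fst z" "snd z"] that by (auto simp: prod_eq_iff)
  qed (use assms in simp)
qed

lemma differentiable_spray:
  assumes "z \<in> U \<times> UNIV"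
  shows "spray differentiable at z"
proof (cases "snd z = 0")
  case True
  then show ?thesis
    using spray_has_derivative_zero_section[of "fst z"] assms unfolding differentiable_def
    by (metis mem_Times_iff prod.collapse)
next
  case False
  then show ?thesis
    using assms by (intro smooth_on_imp_differentiable[OF smooth_spray]) auto
qed

lemma fst_FD_spray:
  assumes "z \<in> U \<times> UNIV"
  shows "fst (FD spray z u) = snd u"
proof -
  have "((\<lambda>z. fst (spray z)) has_derivative (\<lambda>u. fst (FD spray z u))) (at z)"
    by (intro has_derivative_fst FD_works differentiable_spray assms)
  moreover have "((\<lambda>z. fst (spray z)) has_derivative snd) (at z)"
  proof (rule has_derivative_transform_within_open[OF _ _ assms])
    show "(snd has_derivative snd) (at z)"
      by (rule bounded_linear_imp_has_derivative[OF bounded_linear_snd])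
    show "open (U \<times> (UNIV :: 'e set))"
      by (intro open_Times open_U open_UNIV)
  qed (use fst_spray in auto)
  ultimately have "(\<lambda>u. fst (FD spray z u)) = snd"
    by (rule has_derivative_unique)
  then show ?thesis
    by (rule fun_cong)
qed

text \<open>This is \<open>2 de(h\<^sub>0 u) = 0\<close>, because in coordinates \<open>2 h\<^sub>0 u = u + DS(J u) - (0, snd u)\<close>.\<close>

lemma Berwald_identity:
  assumes "z \<in> U \<times> (- {0})"
  shows "FD e z u + FD e z (FD spray z (0, fst u)) - FD e z (0, snd u) = 0"
proof -
  have "FD e z u = FD e z (fst u, 0) + FD e z (0, snd u)"
    using linear_add[OF linear_FD_e[OF assms], of "(fst u, 0)" "(0, snd u)"] by simp
  then show ?thesis
    using FD_e_FD_spray_vertical[OF assms, of "fst u"] by simp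
qed

end

section \<open>The canonical spray and the Berwald connection\<close>

locale finsler_manifold =
  fixes A :: "('m, 'e::euclidean_space) chart set" and E :: "('m, 'e) tpoint \<Rightarrow> real"
  assumes Finsler: "Finsler_manifold A E"

sublocale finsler_manifold \<subseteq> atlas A
  using Finsler by unfold_locales (simp add: Finsler_manifold_def connected_smooth_manifold_def)

context finsler_manifold
begin

interpretation T: atlas "tangent_atlas A"
  by (rule atlas_tangent_atlas)

abbreviation energy :: "(('m, 'e) tpoint, 'e \<times> 'e) chart \<Rightarrow> 'e \<times> 'e \<Rightarrow> real" where
  "energy C \<equiv> E \<circ> chart_inv C"

lemma E_zero: "p \<in> carrier_of A \<Longrightarrow> E (p, tzero) = 0"
  using Finsler by (simp add: Finsler_manifold_def)

lemma E_pos: "q \<in> TM0 A \<Longrightarrow> E q > 0"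
  using Finsler unfolding Finsler_manifold_def by blast

lemma E_homogeneous: "(p, v) \<in> TM A \<Longrightarrow> t > 0 \<Longrightarrow> E (p, \<lambda>c. t *\<^sub>R v c) = t\<^sup>2 * E (p, v)"
  using Finsler unfolding Finsler_manifold_def by blast

lemma fundamental_form_nondegenerate:
  "q \<in> TM0 A \<Longrightarrow> v \<in> TTM A q \<Longrightarrow> (\<And>w. w \<in> TTM A q \<Longrightarrow> fundamental_form A E q v w = 0) \<Longrightarrow> v = tzero"
  using Finsler unfolding Finsler_manifold_def by blast

lemma TM0_subset_TM: "TM0 A \<subseteq> TM A"
  by (auto simp: TM0_def)

lemma TM_cases:
  assumes "q \<in> TM A"
  obtains "q \<in> TM0 A" | p where "p \<in> carrier_of A" "q = (p, tzero)" "q \<notin> TM0 A"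
  using assms by (cases q) (auto simp: TM0_def TM_def)

lemma E_nonneg: "q \<in> TM A \<Longrightarrow> E q \<ge> 0"
  using E_pos E_zero by (metis TM_cases less_eq_real_def order_refl)

lemma energy_differentiable:
  assumes "C \<in> charts_at (tangent_atlas A) q"
  shows "energy C differentiable at (snd C q)"
proof -
  have "Ck_fun (tangent_atlas A) 1 (TM A) E"
    using Finsler by (simp add: Finsler_manifold_def)
  then have "Ck_on (Suc 0) (energy C) (snd C ` (fst C \<inter> TM A))"
    using assms by (simp add: Ck_fun_def charts_at_def)
  moreover have "snd C q \<in> snd C ` (fst C \<inter> TM A)"
    using assms charts_at_tangent_atlas_TM[OF assms] by (auto simp: charts_at_def)
  ultimately show ?thesis
    by (simp only: Ck_on.simps)
qed

lemma energy_smooth: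
  assumes "c \<in> A"
  shows "smooth_on (energy (tangent_chart A c)) (snd c ` fst c \<times> (- {0}))"
proof -
  have "smooth_fun (tangent_atlas A) (TM0 A) E"
    using Finsler by (simp add: Finsler_manifold_def)
  then have "smooth_on (energy C) (snd C ` (fst C \<inter> TM0 A))" if "C \<in> tangent_atlas A" for C
    using that by (simp add: smooth_fun_def Ck_fun_def smooth_on_def)
  from this[of "tangent_chart A c"] show ?thesis
    using assms by (simp add: tangent_chart_image_TM0[OF assms] tangent_atlas_def)
qed

lemma differential_E:
  "C \<in> charts_at (tangent_atlas A) q \<Longrightarrow> w \<in> TTM A q \<Longrightarrow>
   differential (tangent_atlas A) E q w = FD (energy C) (snd C q) (w C)"
  by (rule T.differential_eq[OF _ _ energy_differentiable])

text \<open>The energy is nonnegative and vanishes on the zero section, so it has a minimum there.\<close>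

lemma differential_E_zero_section:
  assumes "q \<in> TM A" "q \<notin> TM0 A" "w \<in> TTM A q"
  shows "differential (tangent_atlas A) E q w = 0"
proof -
  obtain p where p: "p \<in> carrier_of A" "q = (p, tzero)"
    using assms TM_cases by metis
  obtain C where C: "C \<in> charts_at (tangent_atlas A) q"
    using TM_ex_chart[OF assms(1)] .
  then have CA: "C \<in> tangent_atlas A" "q \<in> fst C"
    by (auto simp: charts_at_def)
  have "FD (energy C) (snd C q) = (\<lambda>v. 0)"
  proof (rule differential_zero_maxmin[OF _ T.open_chart_image[OF CA(1)] FD_works[OF energy_differentiable[OF C]]])
    show "snd C q \<in> snd C ` fst C" using CA by blast
    have "energy C (snd C q) \<le> energy C y" if "y \<in> snd C ` fst C" for y
    proof -
      have "chart_inv C y \<in> TM A"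
        using T.chart_inv_in[OF that] CA carrier_of_tangent_atlas by (auto simp: carrier_of_def)
      then show ?thesis
        using E_nonneg E_zero[OF p(1)] T.chart_inv_chart[OF CA] p(2) by simp
    qed
    then show "(\<forall>y\<in>snd C ` fst C. energy C y \<le> energy C (snd C q)) \<or>
        (\<forall>y\<in>snd C ` fst C. energy C (snd C q) \<le> energy C y)"
      by blast
  qed
  then show ?thesis
    using differential_E[OF C assms(3)] by simp
qed

text \<open>With \<open>\<alpha> = d\<^sub>J E\<close>, the terms of \<open>X(\<alpha> Y) - Y(\<alpha> X) - \<alpha>[X, Y]\<close> that contain derivatives of the extending fields
  cancel, which leaves an antisymmetrised second derivative of the energy.\<close>

lemma fundamental_form_chart:
  assumes q: "q \<in> TM0 A" and C: "C \<in> charts_at (tangent_atlas A) q"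
    and v: "v \<in> TTM A q" and w: "w \<in> TTM A q"
  shows "fundamental_form A E q v w
    = FD (\<lambda>z. FD (energy C) z (0, fst (w C))) (snd C q) (v C)
      - FD (\<lambda>z. FD (energy C) z (0, fst (v C))) (snd C q) (w C)"
proof -
  let ?TA = "tangent_atlas A" and ?z = "snd C q" and ?e = "energy C"
  let ?al = "d_along ?TA J E"
  have CA: "C \<in> ?TA" "q \<in> fst C"
    using C by (auto simp: charts_at_def)
  obtain c where c: "c \<in> A" "C = tangent_chart A c"
    using CA(1) by (auto simp: tangent_atlas_def)
  let ?S = "snd C ` (fst C \<inter> TM0 A)"
  have S: "open ?S" "?z \<in> ?S"
    using T.open_chart_image_Int[OF manifold_open_TM0 CA(1)] q CA(2) by blast+
  have sm: "smooth_on ?e ?S"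
    using energy_smooth[OF c(1)] tangent_chart_image_TM0[OF c(1)] c(2) by simp
  have al: "?al r u = FD ?e (snd C r) (0, fst (u C))" if "u \<in> TTM A r" "r \<in> fst C" for r u
    using differential_E[OF _ J_in_TTM[OF that(1)], of C] that CA by (simp add: d_along_def J_def charts_at_def)
  have d_al: "differential ?TA (\<lambda>r. ?al r (Y r)) q u
      = FD ?e ?z (0, fst (FD (coord_field Y C) ?z (u C))) + FD (\<lambda>z. FD ?e z (0, fst (Y q C))) ?z (u C)"
    if Y: "differentiable_vfield_at ?TA q Y" and u: "u \<in> TTM A q" for Y u
  proof -
    obtain W where W: "manifold_open ?TA W" "q \<in> W" "\<And>r. r \<in> W \<Longrightarrow> Y r \<in> TTM A r"
      and dY: "coord_field Y C differentiable at ?z"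
      using Y C unfolding differentiable_vfield_at_def by blast
    have "((\<lambda>z. (0::'e, fst (coord_field Y C z))) has_derivative (\<lambda>u. (0, fst (FD (coord_field Y C) ?z u)))) (at ?z)"
      by (intro has_derivative_Pair has_derivative_const has_derivative_fst FD_works dY)
    then have g: "(\<lambda>z. (0::'e, fst (coord_field Y C z))) differentiable at ?z"
      "FD (\<lambda>z. (0::'e, fst (coord_field Y C z))) ?z = (\<lambda>u. (0, fst (FD (coord_field Y C) ?z u)))"
      by (rule differentiableI, rule FD_eq)
    have "((\<lambda>z. FD ?e z (0, fst (coord_field Y C z))) has_derivative
       (\<lambda>u. FD ?e ?z (0, fst (FD (coord_field Y C) ?z u)) + FD (\<lambda>z. FD ?e z (0, fst (Y q C))) ?z u)) (at ?z)"
      using has_derivative_FD_apply[OF S sm g(1)] unfolding g(2) T.chart_inv_chart[OF CA] .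
    then have d: "(((\<lambda>r. ?al r (Y r)) \<circ> chart_inv C) has_derivative
       (\<lambda>u. FD ?e ?z (0, fst (FD (coord_field Y C) ?z u)) + FD (\<lambda>z. FD ?e z (0, fst (Y q C))) ?z u)) (at ?z)"
    proof (rule has_derivative_transform_within_open)
      show "open (snd C ` (fst C \<inter> W))"
        by (rule T.open_chart_image_Int[OF W(1) CA(1)])
      show "?z \<in> snd C ` (fst C \<inter> W)"
        using W(2) CA(2) by blast
      fix z assume "z \<in> snd C ` (fst C \<inter> W)"
      then obtain r where r: "z = snd C r" "r \<in> fst C" "r \<in> W" by auto
      show "FD ?e z (0, fst (coord_field Y C z)) = ((\<lambda>r. ?al r (Y r)) \<circ> chart_inv C) z"
        using al[OF W(3)[OF r(3)] r(2)] T.chart_inv_chart[OF CA(1) r(2)] by (simp add: r(1))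
    qed
    have "differential ?TA (\<lambda>r. ?al r (Y r)) q u = FD ((\<lambda>r. ?al r (Y r)) \<circ> chart_inv C) ?z (u C)"
      by (rule T.differential_eq[OF C u]) (rule differentiableI[OF d])
    then show ?thesis
      by (simp only: FD_eq[OF d])
  qed
  have lin: "linear (FD ?e ?z)"
    by (rule has_derivative_linear[OF FD_works[OF energy_differentiable[OF C]]])
  have main: "differential ?TA (\<lambda>r. ?al r (Y r)) q v - differential ?TA (\<lambda>r. ?al r (X r)) q w
      - ?al q (lie_bracket ?TA X Y q)
    = FD (\<lambda>z. FD ?e z (0, fst (w C))) ?z (v C) - FD (\<lambda>z. FD ?e z (0, fst (v C))) ?z (w C)"
    if "smooth_vfield_near ?TA q X" "smooth_vfield_near ?TA q Y" "X q = v" "Y q = w" for X Y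
  proof -
    have dXY: "differentiable_vfield_at ?TA q X" "differentiable_vfield_at ?TA q Y"
      using that T.smooth_vfield_near_differentiable by blast+
    have "?al q (lie_bracket ?TA X Y q) = FD ?e ?z (0, fst (lie_bracket ?TA X Y q C))"
      by (rule al[OF T.lie_bracket_in_tangent_space[OF dXY] CA(2)])
    also have "(0, fst (lie_bracket ?TA X Y q C))
        = (0, fst (FD (coord_field Y C) ?z (v C))) - (0::'e, fst (FD (coord_field X C) ?z (w C)))"
      using C that(3,4) by (simp add: lie_bracket_def)
    finally have "?al q (lie_bracket ?TA X Y q)
        = FD ?e ?z (0, fst (FD (coord_field Y C) ?z (v C))) - FD ?e ?z (0, fst (FD (coord_field X C) ?z (w C)))"
      by (simp only: linear_diff[OF lin])
    then show ?thesis
      using d_al[OF dXY(1) w] d_al[OF dXY(2) v] that(3,4) by simp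
  qed
  obtain X Y where XY: "smooth_vfield_near ?TA q X" "smooth_vfield_near ?TA q Y" "X q = v" "Y q = w"
    using T.ex_smooth_vfield_extension[OF C v] T.ex_smooth_vfield_extension[OF C w] by blast
  show ?thesis
    unfolding fundamental_form_def ext_deriv_def
  proof (rule the_equality)
    show "\<forall>X Y. smooth_vfield_near ?TA q X \<and> smooth_vfield_near ?TA q Y \<and> X q = v \<and> Y q = w \<longrightarrow>
      FD (\<lambda>z. FD ?e z (0, fst (w C))) ?z (v C) - FD (\<lambda>z. FD ?e z (0, fst (v C))) ?z (w C)
      = differential ?TA (\<lambda>r. ?al r (Y r)) q v - differential ?TA (\<lambda>r. ?al r (X r)) q w
        - ?al q (lie_bracket ?TA X Y q)"
      using main[symmetric] by blast
    fix t assume "\<forall>X Y. smooth_vfield_near ?TA q X \<and> smooth_vfield_near ?TA q Y \<and> X q = v \<and> Y q = w \<longrightarrow>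
      t = differential ?TA (\<lambda>r. ?al r (Y r)) q v - differential ?TA (\<lambda>r. ?al r (X r)) q w
        - ?al q (lie_bracket ?TA X Y q)"
    from this[rule_format, of X Y] XY
    show "t = FD (\<lambda>z. FD ?e z (0, fst (w C))) ?z (v C) - FD (\<lambda>z. FD ?e z (0, fst (v C))) ?z (w C)"
      by (simp only: main[OF XY])
  qed
qed

text \<open>Every chart of the manifold thus carries the local theory; nondegeneracy passes to coordinates because
  each coordinate vector is the component of a tangent vector.\<close>

lemma local_energy_chart:
  assumes c: "c \<in> A"
  shows "local_energy (snd c ` fst c) (energy (tangent_chart A c))"
proof
  show "open (snd c ` fst c)"
    by (rule open_chart_image[OF c])
  show "smooth_on (energy (tangent_chart A c)) (snd c ` fst c \<times> (- {0}))"
    by (rule energy_smooth[OF c])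
  show "energy (tangent_chart A c) (x, t *\<^sub>R y) = t\<^sup>2 * energy (tangent_chart A c) (x, y)"
    if x: "x \<in> snd c ` fst c" and t: "t > 0" for x y t
  proof -
    obtain p where p: "p \<in> fst c" "x = snd c p" using x by blast
    have mem: "tangent_vector A c p y \<in> tangent_space A p"
      by (rule tangent_vector_in_tangent_space[OF c p(1)])
    have "tangent_vector A c p (t *\<^sub>R y) = (\<lambda>d. t *\<^sub>R tangent_vector A c p y d)"
      using c p by (intro tangent_space_eqI[of _ p _ c] tangent_vector_in_tangent_space tangent_space_scaleR)
        (auto simp: tangent_vector_chart)
    moreover have "(p, tangent_vector A c p y) \<in> TM A"
      using mem c p by (auto simp: TM_def carrier_of_def)
    ultimately show ?thesis
      using c p t by (simp add: chart_inv_tangent_chart E_homogeneous)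
  qed
next
  fix z v assume z: "z \<in> snd c ` fst c \<times> (- {0 :: 'e})"
    and v: "\<And>w. FD (\<lambda>z. FD (energy (tangent_chart A c)) z (0, fst w)) z v
      - FD (\<lambda>z. FD (energy (tangent_chart A c)) z (0, fst v)) z w = 0"
  let ?C = "tangent_chart A c"
  have "z \<in> snd ?C ` (fst ?C \<inter> TM0 A)"
    using z tangent_chart_image_TM0[OF c] by simp
  then obtain q where q: "q \<in> fst ?C" "q \<in> TM0 A" "z = snd ?C q" by auto
  have C: "?C \<in> tangent_atlas A" using c by (simp add: tangent_atlas_def)
  let ?v = "tangent_vector (tangent_atlas A) ?C q v"
  have v': "?v \<in> TTM A q" "?v ?C = v"
    by (rule T.tangent_vector_in_tangent_space[OF C q(1)], rule T.tangent_vector_chart[OF C q(1)])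
  have "?v = tzero"
  proof (rule fundamental_form_nondegenerate[OF q(2) v'(1)])
    fix w assume w: "w \<in> TTM A q"
    show "fundamental_form A E q ?v w = 0"
      unfolding fundamental_form_chart[OF q(2) charts_atI[OF C q(1)] v'(1) w] v'(2) q(3)[symmetric] by (rule v)
  qed
  then show "v = 0"
    using v'(2) by simp
qed

text \<open>Off the zero section both sides solve the same nondegenerate linear system, up to the sign in \<open>-(dE)\<^sup>#\<close>; on
  the zero section both vanish by convention.\<close>

lemma canonical_spray_chart:
  assumes c: "c \<in> A" and q: "q \<in> fst (tangent_chart A c)"
  shows "canonical_spray A E q (tangent_chart A c)
      = local_energy.spray (energy (tangent_chart A c)) (snd (tangent_chart A c) q)"
    and "canonical_spray A E q \<in> TTM A q"
proof -
  let ?C = "tangent_chart A c" and ?z = "snd (tangent_chart A c) q"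
  interpret L: local_energy "snd c ` fst c" "energy ?C"
    by (rule local_energy_chart[OF c])
  have C: "?C \<in> tangent_atlas A" using c by (simp add: tangent_atlas_def)
  have Cq: "?C \<in> charts_at (tangent_atlas A) q"
    by (rule charts_atI[OF C q])
  have "canonical_spray A E q ?C = L.spray ?z \<and> canonical_spray A E q \<in> TTM A q"
  proof (cases "q \<in> TM0 A")
    case False
    obtain p where p: "q = (p, tzero)"
      using TM_cases[OF charts_at_tangent_atlas_TM[OF Cq]] False by metis
    have "L.spray ?z = 0"
      by (simp add: L.spray_def p tangent_chart_apply)
    then show ?thesis
      using False T.tzero_in_tangent_space by (simp add: canonical_spray_def sharp_def)
  next
    case True
    have z: "?z \<in> snd c ` fst c \<times> (- {0})"
      using tangent_chart_image_TM0[OF c] q True by blast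
    have ff: "fundamental_form A E q v w = L.omega ?z (v ?C) (w ?C)" if "v \<in> TTM A q" "w \<in> TTM A q" for v w
      using fundamental_form_chart[OF True Cq that] by (simp add: L.omega_def L.hess_def)
    let ?v = "tangent_vector (tangent_atlas A) ?C q (- L.spray ?z)"
    have v: "?v \<in> TTM A q" "?v ?C = - L.spray ?z"
      by (rule T.tangent_vector_in_tangent_space[OF C q], rule T.tangent_vector_chart[OF C q])
    have "sharp A E (differential (tangent_atlas A) E) q = ?v"
      unfolding sharp_def if_P[OF True]
    proof (rule the_equality)
      show "?v \<in> TTM A q \<and> (\<forall>w\<in>TTM A q. fundamental_form A E q ?v w = differential (tangent_atlas A) E q w)"
        using v ff differential_E[OF Cq] L.omega_spray[OF z] linear_neg[OF L.linear_omega_left[OF z]] by simp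
      fix u assume u: "u \<in> TTM A q \<and> (\<forall>w\<in>TTM A q. fundamental_form A E q u w = differential (tangent_atlas A) E q w)"
      have "L.omega ?z (- u ?C) b = - FD (energy ?C) ?z b" for b
      proof -
        let ?w = "tangent_vector (tangent_atlas A) ?C q b"
        have w: "?w \<in> TTM A q" "?w ?C = b"
          by (rule T.tangent_vector_in_tangent_space[OF C q], rule T.tangent_vector_chart[OF C q])
        have "L.omega ?z (u ?C) b = FD (energy ?C) ?z b"
          using u w ff[of u ?w] differential_E[OF Cq w(1)] by auto
        then show ?thesis
          using linear_neg[OF L.linear_omega_left[OF z]] by simp
      qed
      then have "L.spray ?z = - u ?C"
        by (rule L.spray_unique[OF z])
      then have "u ?C = ?v ?C"
        using v(2) by simp
      then show "u = ?v"
        using T.tangent_space_eqI[OF _ v(1) Cq] u by blast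
    qed
    then have "canonical_spray A E q = (\<lambda>D. - ?v D)"
      by (simp add: canonical_spray_def)
    then show ?thesis
      using v T.tangent_space_minus[OF v(1)] by simp
  qed
  then show "canonical_spray A E q ?C = L.spray ?z" "canonical_spray A E q \<in> TTM A q"
    by blast+
qed

lemma canonical_spray_coord_field:
  assumes c: "c \<in> A" and z: "z \<in> snd c ` fst c \<times> UNIV"
  shows "coord_field (canonical_spray A E) (tangent_chart A c) z
      = local_energy.spray (energy (tangent_chart A c)) z"
proof -
  obtain q where q: "q \<in> fst (tangent_chart A c)" "z = snd (tangent_chart A c) q"
    using tangent_chart_image[OF c] z by blast
  have "tangent_chart A c \<in> tangent_atlas A"
    using c by (simp add: tangent_atlas_def)
  then show ?thesis
    using canonical_spray_chart(1)[OF c q(1)] T.chart_inv_chart q by metis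
qed

lemma canonical_spray_FD:
  assumes c: "c \<in> A" and z: "z \<in> snd c ` fst c \<times> UNIV"
  shows "coord_field (canonical_spray A E) (tangent_chart A c) differentiable at z"
    and "FD (coord_field (canonical_spray A E) (tangent_chart A c)) z
      = FD (local_energy.spray (energy (tangent_chart A c))) z"
proof -
  interpret L: local_energy "snd c ` fst c" "energy (tangent_chart A c)"
    by (rule local_energy_chart[OF c])
  have "open (snd c ` fst c \<times> (UNIV :: 'e set))"
    by (intro open_Times L.open_U open_UNIV)
  then have d: "(coord_field (canonical_spray A E) (tangent_chart A c) has_derivative FD L.spray z) (at z)"
    by (rule has_derivative_transform_within_open[OF FD_works[OF L.differentiable_spray[OF z]] _ z])
       (rule canonical_spray_coord_field[OF c, symmetric])
  show "coord_field (canonical_spray A E) (tangent_chart A c) differentiable at z"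
    by (rule differentiableI[OF d])
  show "FD (coord_field (canonical_spray A E) (tangent_chart A c)) z = FD L.spray z"
    by (rule FD_eq[OF d])
qed

lemma canonical_spray_differentiable:
  assumes q: "q \<in> TM A"
  shows "differentiable_vfield_at (tangent_atlas A) q (canonical_spray A E)"
  unfolding differentiable_vfield_at_def
proof (intro conjI ballI)
  have "manifold_open (tangent_atlas A) (TM A)"
    unfolding manifold_open_def
  proof (intro conjI ballI)
    fix C assume C: "C \<in> tangent_atlas A"
    then have "fst C \<inter> TM A = fst C"
      using carrier_of_tangent_atlas by (auto simp: carrier_of_def)
    then show "open (snd C ` (fst C \<inter> TM A))"
      using T.open_chart_image[OF C] by simp
  qed (simp add: carrier_of_tangent_atlas)
  moreover have "canonical_spray A E r \<in> TTM A r" if r: "r \<in> TM A" for r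
  proof -
    obtain C where "C \<in> charts_at (tangent_atlas A) r"
      using TM_ex_chart[OF r] .
    then obtain c where "c \<in> A" "r \<in> fst (tangent_chart A c)"
      by (auto simp: charts_at_def tangent_atlas_def)
    then show ?thesis
      by (rule canonical_spray_chart(2))
  qed
  ultimately show "\<exists>W. manifold_open (tangent_atlas A) W \<and> q \<in> W \<and> (\<forall>r\<in>W. canonical_spray A E r \<in> TTM A r)"
    using q by blast
next
  fix C assume C: "C \<in> charts_at (tangent_atlas A) q"
  then obtain c where c: "c \<in> A" "C = tangent_chart A c" "q \<in> fst C"
    by (auto simp: charts_at_def tangent_atlas_def)
  have "snd C q \<in> snd c ` fst c \<times> UNIV"
    using c tangent_chart_image[OF c(1)] by blast
  then show "coord_field (canonical_spray A E) C differentiable at (snd C q)"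
    unfolding c(2) by (rule canonical_spray_FD(1)[OF c(1)])
qed

text \<open>The general formula for \<open>[J, Y]\<close> with \<open>Y\<close> the spray \<open>S = (y, g)\<close>, whose first component has the
  derivative \<open>u \<mapsto> snd u\<close>.\<close>

lemma Berwald_connection_chart:
  assumes c: "c \<in> A" and q: "q \<in> fst (tangent_chart A c)" and w: "w \<in> TTM A q"
  shows "Berwald_connection A E q w (tangent_chart A c) = (1/2) *\<^sub>R (w (tangent_chart A c)
     + FD (local_energy.spray (energy (tangent_chart A c))) (snd (tangent_chart A c) q) (0, fst (w (tangent_chart A c)))
     - (0, snd (w (tangent_chart A c))))"
proof -
  let ?C = "tangent_chart A c"
  interpret L: local_energy "snd c ` fst c" "energy ?C"
    by (rule local_energy_chart[OF c])
  have C: "?C \<in> charts_at (tangent_atlas A) q"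
    using c q by (auto simp: charts_at_def tangent_atlas_def)
  have z: "snd ?C q \<in> snd c ` fst c \<times> UNIV"
    using q tangent_chart_image[OF c] by blast
  have "vform_bracket (tangent_atlas A) J (canonical_spray A E) q w ?C
    = FD L.spray (snd ?C q) (0, fst (w ?C)) - (0, snd (w ?C))"
    using vform_bracket_J(1)[OF canonical_spray_differentiable w _ C] charts_at_tangent_atlas_TM[OF C]
    by (simp only: canonical_spray_FD(2)[OF c z] L.fst_FD_spray[OF z])
  then show ?thesis
    by (simp only: Berwald_connection_def add_diff_eq)
qed

lemma Berwald_connection_in_TTM:
  assumes "q \<in> TM A" "w \<in> TTM A q"
  shows "Berwald_connection A E q w \<in> TTM A q"
proof -
  have "Berwald_connection A E q w
      = (\<lambda>c. (1/2) *\<^sub>R (w c + vform_bracket (tangent_atlas A) J (canonical_spray A E) q w c))"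
    by (rule ext) (simp add: Berwald_connection_def)
  then show ?thesis
    using T.tangent_space_scaleR[OF T.tangent_space_add[OF assms(2)
      vform_bracket_J(2)[OF canonical_spray_differentiable[OF assms(1)] assms(2,1)]]] by simp
qed

section \<open>The connection of a conservative semibasic form\<close>

lemma vector_1form_in_TTM: "vector_1form A K \<Longrightarrow> q \<in> TM A \<Longrightarrow> v \<in> TTM A q \<Longrightarrow> K q v \<in> TTM A q"
  by (simp add: vector_1form_def)

lemma differential_E_conservative_semibasic:
  assumes L: "conservative_semibasic A E L" and q: "q \<in> TM A" and w: "w \<in> TTM A q"
  shows "differential (tangent_atlas A) E q (L q w) = 0"
proof -
  obtain h1 h2 where h: "conservative_connection A E h1" "conservative_connection A E h2"
    and Lh: "L q w = (\<lambda>c. h1 q w c - h2 q w c)"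
    using L q w unfolding conservative_semibasic_def by blast
  obtain C where C: "C \<in> charts_at (tangent_atlas A) q"
    using TM_ex_chart[OF q] .
  have hT: "h1 q w \<in> TTM A q" "h2 q w \<in> TTM A q"
    using h vector_1form_in_TTM[OF _ q w] by (simp_all add: conservative_connection_def Ehresmann_connection_def)
  have 0: "differential (tangent_atlas A) E q (h1 q w) = 0" "differential (tangent_atlas A) E q (h2 q w) = 0"
    using h q w unfolding conservative_connection_def d_along_def by blast+
  have lin: "linear (FD (energy C) (snd C q))"
    by (rule has_derivative_linear[OF FD_works[OF energy_differentiable[OF C]]])
  have "differential (tangent_atlas A) E q (L q w) = FD (energy C) (snd C q) (h1 q w C - h2 q w C)"
    using differential_E[OF C T.tangent_space_diff[OF hT]] by (simp add: Lh)
  also have "\<dots> = differential (tangent_atlas A) E q (h1 q w) - differential (tangent_atlas A) E q (h2 q w)"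
    by (simp only: linear_diff[OF lin] differential_E[OF C hT(1)] differential_E[OF C hT(2)])
  finally show ?thesis
    by (simp add: 0)
qed

text \<open>The zero vector solves the defining equation, and nondegeneracy makes the solution unique.\<close>

lemma sharp_zero:
  assumes "\<And>w. w \<in> TTM A q \<Longrightarrow> \<beta> q w = 0"
  shows "sharp A E \<beta> q = tzero"
proof (cases "q \<in> TM0 A")
  case True
  then obtain C where C: "C \<in> charts_at (tangent_atlas A) q"
    using TM0_subset_TM TM_ex_chart by blast
  have z: "snd C q \<in> snd C ` (fst C \<inter> TM0 A)"
    using C True by (auto simp: charts_at_def)
  obtain c where c: "c \<in> A" "C = tangent_chart A c"
    using C by (auto simp: charts_at_def tangent_atlas_def)
  interpret L: local_energy "snd c ` fst c" "energy C"
    unfolding c(2) by (rule local_energy_chart[OF c(1)])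
  have z': "snd C q \<in> snd c ` fst c \<times> (- {0})"
    using z tangent_chart_image_TM0[OF c(1)] c(2) by simp
  have "fundamental_form A E q tzero w = L.omega (snd C q) 0 (w C)" if "w \<in> TTM A q" for w
    using fundamental_form_chart[OF True C T.tzero_in_tangent_space that] by (simp add: L.omega_def L.hess_def)
  then have "fundamental_form A E q tzero w = 0" if "w \<in> TTM A q" for w
    using that linear_0[OF L.linear_omega_left[OF z']] by simp
  then show ?thesis
    unfolding sharp_def if_P[OF True] using assms fundamental_form_nondegenerate[OF True] T.tzero_in_tangent_space
    by (intro the_equality) auto
qed (simp add: sharp_def)

lemma vform_bracket_J_zero:
  assumes "q \<in> TM A" "w \<in> TTM A q"
  shows "vform_bracket (tangent_atlas A) J (\<lambda>_. tzero) q w = tzero"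
proof -
  have d: "differentiable_vfield_at (tangent_atlas A) q (\<lambda>_. tzero)"
  proof -
    obtain C where C: "C \<in> charts_at (tangent_atlas A) q"
      using TM_ex_chart[OF assms(1)] .
    then have "manifold_open (tangent_atlas A) (fst C)" "q \<in> fst C"
      using T.manifold_open_chart by (auto simp: charts_at_def)
    then show ?thesis
      using T.tzero_in_tangent_space by (auto simp: differentiable_vfield_at_def)
  qed
  obtain C where C: "C \<in> charts_at (tangent_atlas A) q"
    using TM_ex_chart[OF assms(1)] .
  show ?thesis
    using vform_bracket_J(1)[OF d assms(2,1) C]
    by (intro T.tangent_space_eqI[OF vform_bracket_J(2)[OF d assms(2,1)] T.tzero_in_tangent_space C])
       (simp add: zero_prod_def)
qed

text \<open>A conservative \<open>L\<close> satisfies \<open>d\<^sub>L E = 0\<close>, so the third summand of \<open>h\<^sub>L\<close> is \<open>[J, 0] = 0\<close>.\<close>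

lemma L_connection_eq:
  assumes "conservative_semibasic A E L" "q \<in> TM A" "w \<in> TTM A q"
  shows "L_connection A E L q w = (\<lambda>c. Berwald_connection A E q w c + L q w c)"
proof -
  have "sharp A E (d_along (tangent_atlas A) L E) r = tzero" for r
  proof (cases "r \<in> TM0 A")
    case True
    then have "r \<in> TM A"
      using TM0_subset_TM by blast
    then show ?thesis
      using differential_E_conservative_semibasic[OF assms(1)]
      by (intro sharp_zero) (simp add: d_along_def)
  qed (simp add: sharp_def)
  then have "sharp A E (d_along (tangent_atlas A) L E) = (\<lambda>_. tzero)"
    by (rule ext)
  then show ?thesis
    by (simp only: L_connection_def vform_bracket_J_zero[OF assms(2,3)] add_0_right)
qed

lemma L_connection_chart:
  assumes L: "conservative_semibasic A E L" and c: "c \<in> A" and q: "q \<in> fst (tangent_chart A c)"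
    and w: "w \<in> TTM A q"
  shows "L_connection A E L q w (tangent_chart A c) = (1/2) *\<^sub>R (w (tangent_chart A c)
     + FD (local_energy.spray (energy (tangent_chart A c))) (snd (tangent_chart A c) q) (0, fst (w (tangent_chart A c)))
     - (0, snd (w (tangent_chart A c)))) + L q w (tangent_chart A c)"
proof -
  have "q \<in> TM A"
    using c q charts_at_tangent_atlas_TM[of "tangent_chart A c" q] by (simp add: charts_at_def tangent_atlas_def)
  then show ?thesis
    using L_connection_eq[OF L _ w] Berwald_connection_chart[OF c q w] by simp
qed

lemma conservative_semibasicD:
  assumes "conservative_semibasic A E L"
  shows "semibasic A L" "vector_1form A L"
  using assms by (simp_all add: conservative_semibasic_def semibasic_def)

lemma L_connection_in_TTM:
  assumes "conservative_semibasic A E L" "q \<in> TM A" "w \<in> TTM A q"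
  shows "L_connection A E L q w \<in> TTM A q"
  unfolding L_connection_eq[OF assms]
  by (rule T.tangent_space_add[OF Berwald_connection_in_TTM[OF assms(2,3)]
        vector_1form_in_TTM[OF conservative_semibasicD(2)[OF assms(1)] assms(2,3)]])

text \<open>The horizontal components are those of \<open>w\<close> because \<open>DS(0, a) = (a, \<dots>)\<close> and \<open>L\<close> has vertical values.\<close>

lemma fst_L_connection:
  assumes L: "conservative_semibasic A E L" and C: "C \<in> charts_at (tangent_atlas A) q" and w: "w \<in> TTM A q"
  shows "fst (L_connection A E L q w C) = fst (w C)"
proof -
  obtain c where c: "c \<in> A" "C = tangent_chart A c" "q \<in> fst (tangent_chart A c)"
    using C by (auto simp: charts_at_def tangent_atlas_def)
  interpret loc: local_energy "snd c ` fst c" "energy C"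
    unfolding c(2) by (rule local_energy_chart[OF c(1)])
  have q: "q \<in> TM A"
    by (rule charts_at_tangent_atlas_TM[OF C])
  have z: "snd C q \<in> snd c ` fst c \<times> UNIV"
    using c tangent_chart_image[OF c(1)] by blast
  have "J q (L q w) = tzero"
    using conservative_semibasicD(1)[OF L] q w unfolding semibasic_def by blast
  from fun_cong[OF this, of C] have "fst (L q w C) = 0"
    by (simp add: J_def zero_prod_def)
  then show ?thesis
    using L_connection_chart[OF L c(1,3) w] loc.fst_FD_spray[OF z, of "(0, fst (w C))"]
    by (simp add: c(2)[symmetric] scaleR_2[symmetric])
qed

lemma L_connection_eq_tzero_iff:
  assumes L: "conservative_semibasic A E L" and q: "q \<in> TM A" and w: "w \<in> TTM A q"
  shows "L_connection A E L q w = tzero \<longleftrightarrow> vertical w"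
proof -
  obtain C where C: "C \<in> charts_at (tangent_atlas A) q"
    using TM_ex_chart[OF q] .
  then obtain c where c: "c \<in> A" "C = tangent_chart A c" "q \<in> fst (tangent_chart A c)"
    by (auto simp: charts_at_def tangent_atlas_def)
  interpret loc: local_energy "snd c ` fst c" "energy C"
    unfolding c(2) by (rule local_energy_chart[OF c(1)])
  have z: "snd C q \<in> snd c ` fst c \<times> UNIV"
    using c tangent_chart_image[OF c(1)] by blast
  show ?thesis
  proof
    assume "L_connection A E L q w = tzero"
    then have "fst (w C) = 0"
      using fst_L_connection[OF L C w] by simp
    then show "vertical w"
      using vertical_iff[OF w C] by simp
  next
    assume vert: "vertical w"
    then obtain u where "u \<in> TTM A q" "w = J q u"
      using vertical_in_image_J[OF w _ q] by blast
    then have "L q w = tzero"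
      using conservative_semibasicD(1)[OF L] q unfolding semibasic_def by blast
    moreover have "FD loc.spray (snd C q) (0, fst (w C)) = 0"
      using linear_0[OF bounded_linear.linear[OF bounded_linear_FD[OF loc.differentiable_spray[OF z]]]]
        vert by (simp add: vertical_def zero_prod_def del: split_paired_All)
    moreover have "w C = (0, snd (w C))"
      using vertical_iff[OF w C] vert by (simp add: prod_eq_iff)
    ultimately have "L_connection A E L q w C = tzero C"
      using L_connection_chart[OF L c(1,3) w] by (simp add: c(2)[symmetric])
    then show "L_connection A E L q w = tzero"
      by (rule T.tangent_space_eqI[OF L_connection_in_TTM[OF L q w] T.tzero_in_tangent_space C])
  qed
qed

lemma L_connection_linear:
  assumes L: "conservative_semibasic A E L" and q: "q \<in> TM A" and v: "v \<in> TTM A q" and w: "w \<in> TTM A q"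
  shows "L_connection A E L q (\<lambda>c. a *\<^sub>R v c + b *\<^sub>R w c)
    = (\<lambda>c. a *\<^sub>R L_connection A E L q v c + b *\<^sub>R L_connection A E L q w c)"
proof -
  obtain C where C: "C \<in> charts_at (tangent_atlas A) q"
    using TM_ex_chart[OF q] .
  then obtain c where c: "c \<in> A" "C = tangent_chart A c" "q \<in> fst (tangent_chart A c)"
    by (auto simp: charts_at_def tangent_atlas_def)
  interpret loc: local_energy "snd c ` fst c" "energy C"
    unfolding c(2) by (rule local_energy_chart[OF c(1)])
  have z: "snd C q \<in> snd c ` fst c \<times> UNIV"
    using c tangent_chart_image[OF c(1)] by blast
  let ?vw = "\<lambda>c. a *\<^sub>R v c + b *\<^sub>R w c" and ?F = "FD loc.spray (snd C q)"
  have vw: "?vw \<in> TTM A q"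
    by (rule T.tangent_space_combination[OF v w])
  have lin: "linear ?F"
    by (rule bounded_linear.linear[OF bounded_linear_FD[OF loc.differentiable_spray[OF z]]])
  have "(0::'e, fst (?vw C)) = a *\<^sub>R (0, fst (v C)) + b *\<^sub>R (0, fst (w C))"
    by simp
  then have F: "?F (0, fst (?vw C)) = a *\<^sub>R ?F (0, fst (v C)) + b *\<^sub>R ?F (0, fst (w C))"
    by (simp only: linear_add[OF lin] linear_scale[OF lin])
  have Lvw: "L q ?vw C = a *\<^sub>R L q v C + b *\<^sub>R L q w C"
  proof -
    have "L q ?vw = (\<lambda>c. a *\<^sub>R L q v c + b *\<^sub>R L q w c)"
      using conservative_semibasicD(2)[OF L] q v w unfolding vector_1form_def by blast
    then show ?thesis
      by (rule fun_cong)
  qed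
  have s: "(0::'e, snd (?vw C)) = a *\<^sub>R (0, snd (v C)) + b *\<^sub>R (0, snd (w C))"
    by simp
  have "L_connection A E L q ?vw C = (1/2) *\<^sub>R (?vw C + ?F (0, fst (?vw C)) - (0, snd (?vw C))) + L q ?vw C"
    using L_connection_chart[OF L c(1,3) vw] by (simp only: c(2))
  also have "\<dots> = (1/2) *\<^sub>R (a *\<^sub>R v C + b *\<^sub>R w C + (a *\<^sub>R ?F (0, fst (v C)) + b *\<^sub>R ?F (0, fst (w C)))
      - (a *\<^sub>R (0, snd (v C)) + b *\<^sub>R (0, snd (w C)))) + (a *\<^sub>R L q v C + b *\<^sub>R L q w C)"
    by (simp only: F s Lvw)
  also have "\<dots> = a *\<^sub>R ((1/2) *\<^sub>R (v C + ?F (0, fst (v C)) - (0, snd (v C))) + L q v C)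
      + b *\<^sub>R ((1/2) *\<^sub>R (w C + ?F (0, fst (w C)) - (0, snd (w C))) + L q w C)"
    by (simp only: scaleR_add_right scaleR_diff_right scaleR_left_commute[of a "1/2"] scaleR_left_commute[of b "1/2"])
       (simp only: algebra_simps)
  also have "\<dots> = a *\<^sub>R L_connection A E L q v C + b *\<^sub>R L_connection A E L q w C"
    using L_connection_chart[OF L c(1,3) v] L_connection_chart[OF L c(1,3) w] by (simp only: c(2))
  finally show ?thesis
    by (rule T.tangent_space_eqI[OF L_connection_in_TTM[OF L q vw] T.tangent_space_combination[OF
          L_connection_in_TTM[OF L q v] L_connection_in_TTM[OF L q w]] C])
qed

text \<open>The difference of \<open>h w\<close> and \<open>w\<close> is vertical, and \<open>h\<close> kills vertical vectors.\<close>

lemma L_connection_idempotent: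
  assumes L: "conservative_semibasic A E L" and q: "q \<in> TM A" and w: "w \<in> TTM A q"
  shows "L_connection A E L q (L_connection A E L q w) = L_connection A E L q w"
proof -
  let ?h = "L_connection A E L q"
  \<comment> \<open>the vertical vector \<open>h w - w\<close>, written as a linear combination\<close>
  let ?u = "\<lambda>c. 1 *\<^sub>R ?h w c + (-1) *\<^sub>R w c"
  obtain C where C: "C \<in> charts_at (tangent_atlas A) q"
    using TM_ex_chart[OF q] .
  have hw: "?h w \<in> TTM A q"
    by (rule L_connection_in_TTM[OF L q w])
  have u: "?u \<in> TTM A q"
    by (rule T.tangent_space_combination[OF hw w])
  have "fst (?u C) = 0"
    using fst_L_connection[OF L C w] by simp
  then have "?h ?u = tzero"
    using L_connection_eq_tzero_iff[OF L q u] vertical_iff[OF u C] by simp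
  then have "(\<lambda>c. 1 *\<^sub>R ?h (?h w) c + (-1) *\<^sub>R ?h w c) = tzero"
    unfolding L_connection_linear[OF L q hw w] .
  from fun_cong[OF this] have "?h (?h w) c = ?h w c" for c
    by simp
  then show ?thesis
    by (rule ext)
qed

text \<open>In coordinates the connection is built from the derivative of the spray, which is smooth off the zero section.\<close>

lemma L_connection_smooth:
  assumes L: "conservative_semibasic A E L"
    and W: "manifold_open (tangent_atlas A) W" "W \<subseteq> TM0 A" and X: "smooth_vfield (tangent_atlas A) W X"
  shows "smooth_vfield (tangent_atlas A) W (\<lambda>p. L_connection A E L p (X p))"
  unfolding smooth_vfield_def
proof (intro conjI ballI)
  have XT: "X q \<in> TTM A q" if "q \<in> W" for q
    using X that by (simp add: smooth_vfield_def)
  show "L_connection A E L q (X q) \<in> TTM A q" if "q \<in> W" for q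
    using that W(2) TM0_subset_TM XT by (intro L_connection_in_TTM[OF L]) auto
  fix C assume C: "C \<in> tangent_atlas A"
  then obtain c where c: "c \<in> A" "C = tangent_chart A c"
    by (auto simp: tangent_atlas_def)
  interpret loc: local_energy "snd c ` fst c" "energy C"
    unfolding c(2) by (rule local_energy_chart[OF c(1)])
  let ?S = "snd C ` (fst C \<inter> W)" and ?X = "coord_field X C" and ?LX = "coord_field (\<lambda>p. L p (X p)) C"
  have S: "open ?S"
    by (rule T.open_chart_image_Int[OF W(1) C])
  have sub: "?S \<subseteq> snd c ` fst c \<times> (- {0})"
    using W(2) tangent_chart_image_TM0[OF c(1)] c(2) by blast
  have sX: "smooth_on ?X ?S"
    using X C by (simp add: smooth_vfield_def)
  have "smooth_vfield (tangent_atlas A) W (\<lambda>p. L p (X p))"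
    using conservative_semibasicD(2)[OF L] W X unfolding vector_1form_def by blast
  then have sL: "smooth_on ?LX ?S"
    using C by (simp add: smooth_vfield_def)
  have "smooth_on (\<lambda>z. (1/2) *\<^sub>R (?X z + FD loc.spray z (0, fst (?X z)) - (0, snd (?X z))) + ?LX z) ?S"
    by (intro smooth_on_add smooth_on_diff S sX sL smooth_on_Pair smooth_on_const
        smooth_on_bounded_linear[OF _ bounded_linear_scaleR_right]
        smooth_on_FD_apply[OF S loc.smooth_spray smooth_on_id]
        smooth_on_bounded_linear[OF _ bounded_linear_fst]
        smooth_on_bounded_linear[OF _ bounded_linear_snd]) (use sub in auto)
  then show "smooth_on (coord_field (\<lambda>p. L_connection A E L p (X p)) C) ?S"
  proof (rule smooth_on_cong[OF S, rotated])
    fix z assume "z \<in> ?S"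
    then obtain q where q: "z = snd C q" "q \<in> fst C" "q \<in> W" by auto
    have "chart_inv C z = q"
      using T.chart_inv_chart[OF C q(2)] q(1) by simp
    then show "(1/2) *\<^sub>R (?X z + FD loc.spray z (0, fst (?X z)) - (0, snd (?X z))) + ?LX z
        = coord_field (\<lambda>p. L_connection A E L p (X p)) C z"
      using L_connection_chart[OF L c(1) _ XT[OF q(3)]] q(1,2) by (simp only: c(2))
  qed
qed

lemma L_connection_Ehresmann:
  assumes L: "conservative_semibasic A E L"
  shows "Ehresmann_connection A (L_connection A E L)"
proof -
  have "vector_1form A (L_connection A E L)"
    unfolding vector_1form_def
    using L_connection_in_TTM[OF L] L_connection_linear[OF L] L_connection_smooth[OF L] by blast
  then show ?thesis
    unfolding Ehresmann_connection_def
    using L_connection_idempotent[OF L] L_connection_eq_tzero_iff[OF L] by blast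
qed

text \<open>On the zero section \<open>dE = 0\<close>. Elsewhere the Berwald part is the coordinate identity for the spray, and
  the part of \<open>L\<close> vanishes because \<open>L\<close> is conservative.\<close>

lemma differential_E_L_connection:
  assumes L: "conservative_semibasic A E L" and q: "q \<in> TM A" and w: "w \<in> TTM A q"
  shows "differential (tangent_atlas A) E q (L_connection A E L q w) = 0"
proof (cases "q \<in> TM0 A")
  case False
  then show ?thesis
    using differential_E_zero_section[OF q _ L_connection_in_TTM[OF L q w]] by blast
next
  case True
  obtain C where C: "C \<in> charts_at (tangent_atlas A) q"
    using TM_ex_chart[OF q] .
  then obtain c where c: "c \<in> A" "C = tangent_chart A c" "q \<in> fst (tangent_chart A c)"
    by (auto simp: charts_at_def tangent_atlas_def)
  interpret loc: local_energy "snd c ` fst c" "energy C"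
    unfolding c(2) by (rule local_energy_chart[OF c(1)])
  have z: "snd C q \<in> snd c ` fst c \<times> (- {0})"
    using c True tangent_chart_image_TM0[OF c(1)] by blast
  let ?D = "FD (energy C) (snd C q)" and ?F = "FD loc.spray (snd C q)"
  note lin = loc.linear_FD_e[OF z]
  have "differential (tangent_atlas A) E q (L_connection A E L q w) = ?D (L_connection A E L q w C)"
    by (rule differential_E[OF C L_connection_in_TTM[OF L q w]])
  also have "L_connection A E L q w C = (1/2) *\<^sub>R (w C + ?F (0, fst (w C)) - (0, snd (w C))) + L q w C"
    using L_connection_chart[OF L c(1,3) w] by (simp only: c(2))
  also have "?D \<dots> = (1/2) *\<^sub>R (?D (w C) + ?D (?F (0, fst (w C))) - ?D (0, snd (w C))) + ?D (L q w C)"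
    by (simp only: linear_add[OF lin] linear_diff[OF lin] linear_scale[OF lin])
  also have "?D (w C) + ?D (?F (0, fst (w C))) - ?D (0, snd (w C)) = 0"
    by (rule loc.Berwald_identity[OF z])
  also have "?D (L q w C) = 0"
    using differential_E_conservative_semibasic[OF L q w]
      differential_E[OF C vector_1form_in_TTM[OF conservative_semibasicD(2)[OF L] q w]] by simp
  finally show ?thesis
    by simp
qed

end

theorem proposition2:
  fixes A :: "('m, 'e::euclidean_space) chart set"
    and E :: "('m, 'e) tpoint \<Rightarrow> real"
    and L :: "(('m, 'e) tpoint, 'e \<times> 'e) vform1"
  assumes "Finsler_manifold A E"
    and "conservative_semibasic A E L"
  shows "conservative_connection A E (L_connection A E L)"
proof -
  interpret finsler_manifold A E
    by (rule finsler_manifold.intro) (rule assms(1))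
  show ?thesis
    unfolding conservative_connection_def d_along_def
    using L_connection_Ehresmann[OF assms(2)] differential_E_L_connection[OF assms(2)] by blast
qed

end
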